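(* (1) Let $X$ be a path-connected topological space and $x_0\in X$. Then $X$ is unbased semilocally simply connected if and only if it has an open covering $\mathcal U$ such that $\pi(\mathcal U,x_0)$ is trivial. (2) Let $X$ be a path-connected topological space and $x_0\in X$. Then $X$ is (based) semilocally simply connected if and only if it has an open covering $\mathcal V$ by pointed sets such that $\pi^*(\mathcal V,x_0)$ is trivial. (3) Let $X$ be a path-connected topological space. Then the two equivalent properties in (1) imply the two equivalent properties in (2). (4) Let $X$ be a path-connected and locally path-connected topological space. Then the two equivalent properties in (2) imply the two equivalent properties in (1). (5) For path-connected topological spaces that are not locally path-connected, the properties in (2) need not imply those in (1): the space $Y\subset\mathbb R^3$ (defined in the context) satisfies the properties in (2) but not those in (1).
   Context: All topological spaces are assumed to be path-connected. Semilocal simple connectivity. A space $X$ is (based) semilocally simply connected if for every $x\in X$ there is a neighbourhood $U$ of $x$ such that the inclusion-induced homomorphism $\pi_1(U,x)\to\pi_1(X,x)$ is trivial. A space $X$ is unbased semilocally simply connected if for every $x\in X$ there is a neighbourhood $U$ of $x$ such that every loop in $U$ (with any base point in $U$) is null-homotopic in $X$. Unbased Spanier group. For an open covering $\mathcal U=\{U_i\mid i\in I\}$ of $X$ and $x_0\in X$, $\pi(\mathcal U,x_0)$ is the subgroup of $\pi_1(X,x_0)$ consisting of all homotopy classes having representatives of the form $\prod_{j=1}^n u_j v_j u_j^{-1}$, where the $u_j$ are arbitrary paths starting at $x_0$ and each $v_j$ is a loop, based at the endpoint of $u_j$, lying inside one of the sets $U_i\in\mathcal U$. Based Spanier group. A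 pointed open set is a pair $(U,x)$ with $U$ open and $x\in U$. An open covering of $X$ by pointed sets is a family $\mathcal V=\{(U_i,x_i)\mid i\in I\}$ of pointed open sets of $X$ such that $\{x_i\mid i\in I\}=X$ (every point of $X$ occurs as a base point at least once). For such $\mathcal V$ and $x_0\in X$, $\pi^*(\mathcal V,x_0)$ is the subgroup of $\pi_1(X,x_0)$ consisting of all homotopy classes having representatives of the form $\prod_{j=1}^n u_j v_j u_j^{-1}$, where each $u_j$ is a path from $x_0$ to some point $x_i$ and $v_j$ is a closed path based at $x_i$ inside the corresponding $U_i$. The space $Y$. $Y\subset\mathbb R^3$ (with the subspace topology) is the union of three pieces: (i) the surface portion, a topologists' sine curve rotated about the $z$-axis, $\{(r\cos\varphi,r\sin\varphi,\sin(1/r)) : 0<r\le 1,\ \varphi\in[0,2\pi]\}$; (ii) the central axis $\{(0,0)\}\times[-1,1]$, to which the surface tends as $r\to 0$; (iii) a single arc $C$ embedded in $\mathbb R^3$, with one endpoint on the central axis and the other endpoint on the surface portion, which meets the union of the surface portion and the central axis only in its two endpoints. *)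

theory Defs
  imports "HOL-Analysis.Analysis" "HOL-Algebra.Coset"
begin

text \<open>
  A topological space is a set \<open>X :: 'a::topological_space set\<close> with its subspace topology
  \<^term>\<open>top_of_set X\<close>; the choice \<^term>\<open>UNIV\<close> gives the whole type.  Paths are the library's paths,
  defined on the interval from 0 to 1.
\<close>

definition loop_at :: "'a::topological_space set \<Rightarrow> 'a \<Rightarrow> (real \<Rightarrow> 'a) \<Rightarrow> bool" where
  "loop_at X x p \<longleftrightarrow> path p \<and> path_image p \<subseteq> X \<and> pathstart p = x \<and> pathfinish p = x"

definition path_class :: "'a::topological_space set \<Rightarrow> (real \<Rightarrow> 'a) \<Rightarrow> (real \<Rightarrow> 'a) set" where
  "path_class X p = {q. homotopic_paths X p q}"

definition fundamental_group ::
    "'a::topological_space set \<Rightarrow> 'a \<Rightarrow> (real \<Rightarrow> 'a) set monoid" where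
  "fundamental_group X x =
     \<lparr>carrier = {path_class X p | p. loop_at X x p},
      mult = (\<lambda>c d. \<Union>p\<in>c. \<Union>q\<in>d. path_class X (p +++ q)),
      one = path_class X (\<lambda>_. x)\<rparr>"

text \<open>The map induced by the inclusion of a subspace into \<open>X\<close>; the argument is a homotopy class in
  the subspace.\<close>

definition inclusion_induced ::
    "'a::topological_space set \<Rightarrow> (real \<Rightarrow> 'a) set \<Rightarrow> (real \<Rightarrow> 'a) set" where
  "inclusion_induced X c = (\<Union>p\<in>c. path_class X p)"

text \<open>Neighbourhoods need not be open.\<close>

definition nbhd_in :: "'a::topological_space set \<Rightarrow> 'a \<Rightarrow> 'a set \<Rightarrow> bool" where
  "nbhd_in X x U \<longleftrightarrow> U \<subseteq> X \<and> (\<exists>W. openin (top_of_set X) W \<and> x \<in> W \<and> W \<subseteq> U)"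

definition semilocally_simply_connected :: "'a::topological_space set \<Rightarrow> bool" where
  "semilocally_simply_connected X \<longleftrightarrow>
     (\<forall>x\<in>X. \<exists>U. nbhd_in X x U \<and>
        trivial_homomorphism (fundamental_group U x) (fundamental_group X x)
          (inclusion_induced X))"

definition unbased_semilocally_simply_connected :: "'a::topological_space set \<Rightarrow> bool" where
  "unbased_semilocally_simply_connected X \<longleftrightarrow>
     (\<forall>x\<in>X. \<exists>U. nbhd_in X x U \<and>
        (\<forall>y\<in>U. \<forall>p. loop_at U y p \<longrightarrow> (\<exists>a. homotopic_loops X p (\<lambda>_. a))))"

text \<open>Only the set of members of an indexed covering matters for the Spanier groups, so a covering
  is a set of open sets, and a covering by pointed sets is a set of pairs, in which the same open
  set and the same base point may occur in several pairs.\<close>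

definition open_covering :: "'a::topological_space set \<Rightarrow> 'a set set \<Rightarrow> bool" where
  "open_covering X \<U> \<longleftrightarrow> (\<forall>U\<in>\<U>. openin (top_of_set X) U) \<and> \<Union>\<U> = X"

definition pointed_open_covering ::
    "'a::topological_space set \<Rightarrow> ('a set \<times> 'a) set \<Rightarrow> bool" where
  "pointed_open_covering X \<V> \<longleftrightarrow>
     (\<forall>(U, x)\<in>\<V>. openin (top_of_set X) U \<and> x \<in> U) \<and> snd ` \<V> = X"

fun path_prod :: "'a::topological_space \<Rightarrow> (real \<Rightarrow> 'a) list \<Rightarrow> real \<Rightarrow> 'a" where
  "path_prod x [] = (\<lambda>_. x)"
| "path_prod x [p] = p"
| "path_prod x (p # q # ps) = p +++ path_prod x (q # ps)"

definition lasso :: "(real \<Rightarrow> 'a::topological_space) \<times> (real \<Rightarrow> 'a) \<Rightarrow> real \<Rightarrow> 'a" where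
  "lasso = (\<lambda>(u, v). u +++ v +++ reversepath u)"

definition unbased_spanier_group ::
    "'a::topological_space set \<Rightarrow> 'a set set \<Rightarrow> 'a \<Rightarrow> (real \<Rightarrow> 'a) set set" where
  "unbased_spanier_group X \<U> x0 =
     {path_class X (path_prod x0 (map lasso uvs)) | uvs.
        \<forall>(u, v)\<in>set uvs. path u \<and> path_image u \<subseteq> X \<and> pathstart u = x0 \<and>
          (\<exists>U\<in>\<U>. loop_at U (pathfinish u) v)}"

definition based_spanier_group ::
    "'a::topological_space set \<Rightarrow> ('a set \<times> 'a) set \<Rightarrow> 'a \<Rightarrow> (real \<Rightarrow> 'a) set set" where
  "based_spanier_group X \<V> x0 =
     {path_class X (path_prod x0 (map lasso uvs)) | uvs.
        \<forall>(u, v)\<in>set uvs. path u \<and> path_image u \<subseteq> X \<and> pathstart u = x0 \<and>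
          (\<exists>(U, x)\<in>\<V>. pathfinish u = x \<and> loop_at U x v)}"

definition sine_surface :: "(real^3) set" where
  "sine_surface =
     {vector [r * cos \<phi>, r * sin \<phi>, sin (1 / r)] | r \<phi>. 0 < r \<and> r \<le> 1 \<and> 0 \<le> \<phi> \<and> \<phi> \<le> 2 * pi}"

definition central_axis :: "(real^3) set" where
  "central_axis = {vector [0, 0, z] | z. -1 \<le> z \<and> z \<le> 1}"

definition connecting_arc :: "(real \<Rightarrow> real^3) \<Rightarrow> bool" where
  "connecting_arc g \<longleftrightarrow>
     arc g \<and> pathstart g \<in> central_axis \<and> pathfinish g \<in> sine_surface \<and>
     path_image g \<inter> (sine_surface \<union> central_axis) = {pathstart g, pathfinish g}"

definition space_Y :: "(real \<Rightarrow> real^3) \<Rightarrow> (real^3) set" where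
  "space_Y g = sine_surface \<union> central_axis \<union> path_image g"

lemma path_class_eq_iff:
  assumes "path p" "path_image p \<subseteq> X"
  shows "path_class X p = path_class X q \<longleftrightarrow> homotopic_paths X p q"
proof
  assume "path_class X p = path_class X q"
  moreover have "p \<in> path_class X p"
    using assms by (simp add: path_class_def)
  ultimately show "homotopic_paths X p q"
    by (simp add: path_class_def homotopic_paths_sym)
next
  assume pq: "homotopic_paths X p q"
  have "homotopic_paths X p r \<longleftrightarrow> homotopic_paths X q r" for r
    using homotopic_paths_trans[OF pq] homotopic_paths_trans[OF homotopic_paths_sym[OF pq]] by blast
  then show "path_class X p = path_class X q"
    by (simp add: path_class_def)
qed

lemma fundamental_group_mult:
  assumes "loop_at X x p" "loop_at X x q"
  shows "path_class X p \<otimes>\<^bsub>fundamental_group X x\<^esub> path_class X q = path_class X (p +++ q)"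
proof -
  have "path_class X (p' +++ q') = path_class X (p +++ q)"
    if "homotopic_paths X p p'" "homotopic_paths X q q'" for p' q'
  proof -
    have "homotopic_paths X (p +++ q) (p' +++ q')"
      using that assms by (intro homotopic_paths_join) (auto simp: loop_at_def)
    then show ?thesis
      by (metis homotopic_paths_imp_path homotopic_paths_imp_subset path_class_eq_iff)
  qed
  then have const: "path_class X (p' +++ q') = path_class X (p +++ q)"
    if "p' \<in> path_class X p" "q' \<in> path_class X q" for p' q'
    using that unfolding path_class_def by blast
  have "p \<in> path_class X p" "q \<in> path_class X q"
    using assms by (auto simp: path_class_def loop_at_def)
  then have "(\<Union>p'\<in>path_class X p. \<Union>q'\<in>path_class X q. path_class X (p' +++ q')) =
      path_class X (p +++ q)"
    using const by blast
  then show ?thesis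
    by (simp add: fundamental_group_def)
qed

lemma inclusion_induced_path_class:
  assumes "loop_at U x p" "U \<subseteq> X"
  shows "inclusion_induced X (path_class U p) = path_class X p"
proof -
  have "path_class X p' = path_class X p" if "homotopic_paths U p p'" for p'
    using that assms
    by (metis homotopic_paths_imp_path homotopic_paths_imp_subset homotopic_paths_subset
        path_class_eq_iff)
  then have const: "path_class X p' = path_class X p" if "p' \<in> path_class U p" for p'
    using that unfolding path_class_def by blast
  have "p \<in> path_class U p"
    using assms by (auto simp: path_class_def loop_at_def)
  then show ?thesis
    unfolding inclusion_induced_def using const by blast
qed

lemma homotopic_paths_const_right:
  assumes "path p" "path_image p \<subseteq> X" "pathfinish p = x"
  shows "homotopic_paths X (p +++ (\<lambda>_. x)) p"
proof -
  have f: "continuous_on {0..1} (\<lambda>t::real. if t \<le> 1/2 then 2 *\<^sub>R t else 1)"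
    unfolding split_01
    by (rule continuous_on_cases continuous_intros | force simp: pathfinish_def joinpaths_def)+
  have "homotopic_paths X p (p +++ (\<lambda>_. x))"
    by (rule homotopic_paths_reparametrize[OF assms(1,2) f])
       (use assms in \<open>auto simp: joinpaths_def pathfinish_def\<close>)
  then show ?thesis
    by (rule homotopic_paths_sym)
qed

lemma homotopic_paths_const_left:
  assumes "path p" "path_image p \<subseteq> X" "pathstart p = x"
  shows "homotopic_paths X ((\<lambda>_. x) +++ p) p"
proof -
  have "homotopic_paths X (reversepath p +++ (\<lambda>_. x)) (reversepath p)"
    using assms by (intro homotopic_paths_const_right) auto
  then have "homotopic_paths X (reversepath (reversepath p +++ (\<lambda>_. x))) (reversepath (reversepath p))"
    by (rule homotopic_paths_reversepath_D)
  moreover have "reversepath (reversepath p +++ (\<lambda>_. x)) = reversepath (\<lambda>_. x) +++ p"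
    using assms by (subst reversepath_joinpaths) (auto simp: pathstart_def)
  moreover have "reversepath (\<lambda>_. x) = (\<lambda>_. x)"
    by (simp add: reversepath_def)
  ultimately show ?thesis
    by simp
qed

lemma homotopic_paths_reverse_right:
  assumes "path p" "path_image p \<subseteq> X"
  shows "homotopic_paths X (p +++ reversepath p) (\<lambda>_. pathstart p)"
proof -
  have p: "continuous_on {0..1} p"
    using assms by (auto simp: path_def)
  let ?A = "{0..1::real} \<times> {0..1::real}"
  let ?h = "\<lambda>y::real\<times>real. if snd y \<le> 1/2 then p (fst y * (2 * snd y)) else p (fst y * (1 - (2 * snd y - 1)))"
  have "continuous_on ?A ?h"
  proof (rule continuous_on_cases_le)
    show "continuous_on {x \<in> ?A. snd x \<le> 1/2} (\<lambda>t. p (fst t * (2 * snd t)))"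
         "continuous_on {x \<in> ?A. 1/2 \<le> snd x} (\<lambda>t. p (fst t * (1 - (2 * snd t - 1))))"
         "continuous_on ?A snd"
      by (intro continuous_on_compose2 [OF p] continuous_intros; auto simp: mult_le_one)+
  qed (auto simp: algebra_simps)
  moreover have "?h y \<in> X" if "y \<in> ?A" for y
  proof -
    have "p s \<in> X" if "0 \<le> s" "s \<le> 1" for s
      using assms that by (auto simp: path_image_def)
    with \<open>y \<in> ?A\<close> show ?thesis
      by (auto simp: mult_le_one)
  qed
  ultimately have "homotopic_paths X (\<lambda>_. pathstart p) (p +++ reversepath p)"
    unfolding homotopic_paths
    by (intro exI[of _ ?h])
       (auto simp: pathstart_def pathfinish_def joinpaths_def reversepath_def)
  then show ?thesis
    by (rule homotopic_paths_sym)
qed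

lemma fundamental_group_is_group:
  assumes "x \<in> X"
  shows "group (fundamental_group X x)"
proof -
  let ?G = "fundamental_group X x"
  have carr: "c \<in> carrier ?G \<longleftrightarrow> (\<exists>p. loop_at X x p \<and> c = path_class X p)" for c
    by (auto simp: fundamental_group_def)
  have one: "one ?G = path_class X (\<lambda>_. x)"
    by (simp add: fundamental_group_def)
  have const: "loop_at X x (\<lambda>_. x)"
    using assms by (auto simp: loop_at_def path_def pathstart_def pathfinish_def path_image_def)
  have join: "loop_at X x (p +++ q)" if "loop_at X x p" "loop_at X x q" for p q
    using that by (auto simp: loop_at_def subset_path_image_join)
  have eq: "path_class X p = path_class X q" if "homotopic_paths X p q" for p q
    using that by (metis homotopic_paths_imp_path homotopic_paths_imp_subset path_class_eq_iff)
  show ?thesis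
  proof (rule groupI)
    fix c d assume "c \<in> carrier ?G" "d \<in> carrier ?G"
    then obtain p q where
      pq: "loop_at X x p" "loop_at X x q" "c = path_class X p" "d = path_class X q"
      unfolding carr by blast
    have "c \<otimes>\<^bsub>?G\<^esub> d = path_class X (p +++ q)"
      using pq by (simp add: fundamental_group_mult)
    then show "c \<otimes>\<^bsub>?G\<^esub> d \<in> carrier ?G"
      unfolding carr using join[OF pq(1,2)] by blast
  next
    show "one ?G \<in> carrier ?G"
      unfolding carr one using const by blast
  next
    fix c d e assume "c \<in> carrier ?G" "d \<in> carrier ?G" "e \<in> carrier ?G"
    then obtain p q r where
      pqr: "loop_at X x p" "loop_at X x q" "loop_at X x r"
        "c = path_class X p" "d = path_class X q" "e = path_class X r"
      unfolding carr by blast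
    have "homotopic_paths X (p +++ (q +++ r)) ((p +++ q) +++ r)"
      using pqr by (intro homotopic_paths_assoc) (auto simp: loop_at_def)
    from eq[OF this] show "c \<otimes>\<^bsub>?G\<^esub> d \<otimes>\<^bsub>?G\<^esub> e = c \<otimes>\<^bsub>?G\<^esub> (d \<otimes>\<^bsub>?G\<^esub> e)"
      using pqr join[OF pqr(1,2)] join[OF pqr(2,3)] by (simp add: fundamental_group_mult)
  next
    fix c assume "c \<in> carrier ?G"
    then obtain p where p: "loop_at X x p" "c = path_class X p"
      unfolding carr by blast
    show "\<one>\<^bsub>?G\<^esub> \<otimes>\<^bsub>?G\<^esub> c = c"
      using p const eq[OF homotopic_paths_const_left[of p X x]]
      by (simp add: one fundamental_group_mult loop_at_def)
    have r: "loop_at X x (reversepath p)"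
      using p by (auto simp: loop_at_def)
    have "homotopic_paths X (reversepath p +++ p) (\<lambda>_. x)"
      using homotopic_paths_reverse_right[of "reversepath p" X] p by (auto simp: loop_at_def)
    from eq[OF this] have "path_class X (reversepath p) \<otimes>\<^bsub>?G\<^esub> c = \<one>\<^bsub>?G\<^esub>"
      using p r by (simp add: one fundamental_group_mult)
    then show "\<exists>d\<in>carrier ?G. d \<otimes>\<^bsub>?G\<^esub> c = \<one>\<^bsub>?G\<^esub>"
      using r carr by blast
  qed
qed

lemma inclusion_induced_hom:
  assumes "U \<subseteq> X"
  shows "inclusion_induced X \<in> hom (fundamental_group U x) (fundamental_group X x)"
proof -
  have mono: "loop_at X x p" if "loop_at U x p" for p
    using that assms by (auto simp: loop_at_def)
  have join: "loop_at U x (p +++ q)" if "loop_at U x p" "loop_at U x q" for p q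
    using that by (auto simp: loop_at_def subset_path_image_join)
  have carr: "c \<in> carrier (fundamental_group Z x) \<longleftrightarrow> (\<exists>p. loop_at Z x p \<and> c = path_class Z p)"
    for c Z
    by (auto simp: fundamental_group_def)
  show ?thesis
  proof (rule homI)
    fix c assume "c \<in> carrier (fundamental_group U x)"
    then obtain p where p: "loop_at U x p" "c = path_class U p"
      unfolding carr by blast
    then show "inclusion_induced X c \<in> carrier (fundamental_group X x)"
      unfolding carr using mono[OF p(1)] inclusion_induced_path_class[OF p(1) assms] by blast
  next
    fix c d assume "c \<in> carrier (fundamental_group U x)" "d \<in> carrier (fundamental_group U x)"
    then obtain p q where
      pq: "loop_at U x p" "loop_at U x q" "c = path_class U p" "d = path_class U q"
      unfolding carr by blast
    then show "inclusion_induced X (c \<otimes>\<^bsub>fundamental_group U x\<^esub> d) =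
        inclusion_induced X c \<otimes>\<^bsub>fundamental_group X x\<^esub> inclusion_induced X d"
      using assms mono[OF pq(1)] mono[OF pq(2)] join[OF pq(1,2)]
      by (simp add: fundamental_group_mult inclusion_induced_path_class)
  qed
qed

end

theory Submission
  imports Defs "HOL-Complex_Analysis.Winding_Numbers"
begin

text \<open>
  Parts (1) and (2) rest on one computation in the fundamental groupoid: a lasso \<open>u \<cdot> v \<cdot> u\<inverse>\<close> is
  null-homotopic relative to its end points exactly when the loop \<open>v\<close> is
  (\<open>homotopic_lasso_const_iff\<close>).  The lassos alone already decide whether a Spanier group is trivial,
  and in a path-connected space every base point is reached by some tail \<open>u\<close>.  So triviality of the
  group of a covering says that each loop in a member of the covering dies in \<open>X\<close>, for the based
  group only if it starts at the distinguished point (\<open>unbased_spanier_group_trivial_iff\<close>,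
  \<open>based_spanier_group_trivial_iff\<close>).  Collecting all sufficiently small open sets gives the covering
  in one direction, and the members of the covering are the required neighbourhoods in the other.
  For (1) the free null-homotopies of the definition have to be turned into null-homotopies that fix
  the base point; the path traced by the base point is the tail of a lasso
  (\<open>homotopic_loops_const_imp_homotopic_paths\<close>).  Part (3) is then immediate.  For (4), a loop that
  starts at another point of a small path-connected neighbourhood of \<open>x\<close> is joined to \<open>x\<close> inside the
  neighbourhood, and the resulting lasso is a small loop at \<open>x\<close>.

  The example \<open>Y\<close> consists of the surface and the stem, which is the central axis together with the
  arc; the two meet in the single point where the arc lands on the surface, the junction.  The
  surface oscillates between heights \<open>-1\<close> and \<open>1\<close> near the axis, so a connected set of small vertical
  extent cannot leave the stem without passing through the junction
  (\<open>flat_connected_subset_stem\<close>).  This has two consequences.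

  First, away from the junction a path that starts on the stem stays on it, and the stem is
  contractible, being two arcs with one common point.  Every other point lies on the surface,
  away from the axis, and has a neighbourhood inside a small disc, at the junction with the arc attached.  Hence \<open>Y\<close> is
  semilocally simply connected.

  Secondly, the map from \<open>Y\<close> to the unit circle that sends a surface point to its angle and collapses
  the stem to the angle of the junction is discontinuous along the axis, but its composition with a
  continuous map from a convex set into \<open>Y\<close> is continuous (\<open>continuous_on_direction_compose\<close>).  It
  therefore transports homotopies, and it maps each horizontal circle on the surface to a loop of
  winding number one.  Such circles lie arbitrarily close to the origin, so \<open>Y\<close> is not unbased
  semilocally simply connected.  By (4) it cannot be locally path-connected either.
\<close>

section \<open>Lassos and null-homotopic loops\<close>

lemma homotopic_lasso_const:
  assumes u: "path u" "path_image u \<subseteq> X"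
    and v: "homotopic_paths X v (\<lambda>_. pathfinish u)"
  shows "homotopic_paths X (lasso (u, v)) (\<lambda>_. pathstart u)"
proof -
  have c: "pathstart (\<lambda>_::real. pathfinish u) = pathfinish u" "pathfinish (\<lambda>_::real. pathfinish u) = pathfinish u"
    by (simp_all only: pathstart_def[of "\<lambda>_. pathfinish u"] pathfinish_def[of "\<lambda>_. pathfinish u"])
  have vs: "pathstart v = pathfinish u" "pathfinish v = pathfinish u"
    using homotopic_paths_imp_pathstart[OF v] homotopic_paths_imp_pathfinish[OF v] c by metis+
  have "homotopic_paths X (v +++ reversepath u) ((\<lambda>_. pathfinish u) +++ reversepath u)"
    using u v vs by (intro homotopic_paths_join) auto
  also have "homotopic_paths X ((\<lambda>_. pathfinish u) +++ reversepath u) (reversepath u)"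
    using u by (intro homotopic_paths_const_left) auto
  finally have "homotopic_paths X (u +++ v +++ reversepath u) (u +++ reversepath u)"
    using u vs by (intro homotopic_paths_join) auto
  also have "homotopic_paths X (u +++ reversepath u) (\<lambda>_. pathstart u)"
    using u by (rule homotopic_paths_reverse_right)
  finally show ?thesis
    by (simp add: lasso_def)
qed

text \<open>
  In the fundamental groupoid, \<open>u \<cdot> q = 1\<close> forces \<open>q = u\<inverse>\<close>.
\<close>

lemma homotopic_paths_cancel_left:
  assumes u: "path u" "path_image u \<subseteq> X" and q: "path q" "path_image q \<subseteq> X"
    and uq: "pathfinish u = pathstart q"
    and null: "homotopic_paths X (u +++ q) (\<lambda>_. pathstart u)"
  shows "homotopic_paths X q (reversepath u)"
proof -
  have "homotopic_paths X (reversepath u +++ u) (\<lambda>_. pathstart q)"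
    using homotopic_paths_reverse_right[of "reversepath u" X] u uq by simp
  then have "homotopic_paths X ((reversepath u +++ u) +++ q) ((\<lambda>_. pathstart q) +++ q)"
    using q uq by (intro homotopic_paths_join) auto
  also have "homotopic_paths X ((\<lambda>_. pathstart q) +++ q) q"
    using q by (intro homotopic_paths_const_left) auto
  finally have *: "homotopic_paths X q ((reversepath u +++ u) +++ q)"
    by (rule homotopic_paths_sym)
  also have "homotopic_paths X ((reversepath u +++ u) +++ q) (reversepath u +++ (u +++ q))"
    using u q uq by (intro homotopic_paths_sym[OF homotopic_paths_assoc]) auto
  also have "homotopic_paths X (reversepath u +++ (u +++ q)) (reversepath u +++ (\<lambda>_. pathstart u))"
    using u q uq null by (intro homotopic_paths_join) auto
  also have "homotopic_paths X (reversepath u +++ (\<lambda>_. pathstart u)) (reversepath u)"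
    using u by (intro homotopic_paths_const_right) auto
  finally show ?thesis .
qed

text \<open>
  Cancelling \<open>u\<close> in \<open>u \<cdot> (v \<cdot> u\<inverse>) = 1\<close> leaves \<open>v \<cdot> u\<inverse> = u\<inverse>\<close>, and multiplying by \<open>u\<close> gives \<open>v = 1\<close>.
\<close>

lemma homotopic_lasso_const_iff:
  assumes u: "path u" "path_image u \<subseteq> X" and v: "loop_at X (pathfinish u) v"
  shows "homotopic_paths X (lasso (u, v)) (\<lambda>_. pathstart u) \<longleftrightarrow>
    homotopic_paths X v (\<lambda>_. pathfinish u)" (is "?L \<longleftrightarrow> ?R")
proof
  assume ?L
  have v': "path v" "path_image v \<subseteq> X" "pathstart v = pathfinish u" "pathfinish v = pathfinish u"
    using v by (auto simp: loop_at_def)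
  have "homotopic_paths X (v +++ reversepath u) (reversepath u)"
    using u v' \<open>?L\<close> by (intro homotopic_paths_cancel_left) (auto simp: lasso_def subset_path_image_join)
  then have "homotopic_paths X ((v +++ reversepath u) +++ u) (reversepath u +++ u)"
    using u by (intro homotopic_paths_join) auto
  moreover have inv: "homotopic_paths X (reversepath u +++ u) (\<lambda>_. pathfinish u)"
    using homotopic_paths_reverse_right[of "reversepath u" X] u by simp
  moreover have "homotopic_paths X (v +++ (reversepath u +++ u)) ((v +++ reversepath u) +++ u)"
    using u v' by (intro homotopic_paths_assoc) auto
  moreover have "homotopic_paths X (v +++ (reversepath u +++ u)) (v +++ (\<lambda>_. pathfinish u))"
    using v' inv by (intro homotopic_paths_join) auto
  moreover have "homotopic_paths X (v +++ (\<lambda>_. pathfinish u)) v"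
    using v' by (intro homotopic_paths_const_right) auto
  ultimately show ?R
    by (meson homotopic_paths_sym homotopic_paths_trans)
next
  assume ?R
  with u show ?L by (rule homotopic_lasso_const)
qed

text \<open>
  A free homotopy is a map on the unit square.  There the bottom edge \<open>b\<close> is homotopic to the path
  \<open>w \<cdot> t \<cdot> r\<inverse>\<close> along the other three edges, since the square is simply connected.  The images of \<open>w\<close>
  and \<open>r\<close> agree, both being the track of the base point, and \<open>t\<close> is mapped to a point; so the image
  of the bottom edge, which is \<open>p\<close>, is homotopic to a lasso around a constant loop.
\<close>

lemma homotopic_loops_const_imp_homotopic_paths:
  assumes "homotopic_loops X p (\<lambda>_. a)"
  shows "homotopic_paths X p (\<lambda>_. pathstart p)"
proof -
  let ?K = "{0..1::real} \<times> {0..1::real}"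
  obtain h where h: "continuous_on ?K h" "h \<in> ?K \<rightarrow> X"
    and h0: "\<And>x. x \<in> {0..1} \<Longrightarrow> h (0, x) = p x" and h1: "\<And>x. x \<in> {0..1} \<Longrightarrow> h (1, x) = a"
    and ends: "\<And>t. t \<in> {0..1} \<Longrightarrow> h (t, 1) = h (t, 0)"
    using assms unfolding homotopic_loops by (auto simp: pathstart_def pathfinish_def)
  define b w t r where "b = linepath (0::real, 0::real) (0, 1)" and "w = linepath (0::real, 0::real) (1, 0)"
    and "t = linepath (1::real, 0::real) (1, 1)" and "r = linepath (0::real, 1::real) (1, 1)"
  note defs = b_def w_def t_def r_def
  have K: "simply_connected ?K" "convex ?K"
    by (simp_all add: convex_imp_simply_connected convex_Times)
  have im: "path_image b \<subseteq> ?K" "path_image w \<subseteq> ?K" "path_image t \<subseteq> ?K" "path_image r \<subseteq> ?K"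
    using K(2) unfolding defs by (simp_all add: closed_segment_subset del: convex_closed_interval)
  have "homotopic_paths ?K b (w +++ t +++ reversepath r)"
  proof -
    have all: "homotopic_paths ?K p q" if "path p" "path_image p \<subseteq> ?K" "path q" "path_image q \<subseteq> ?K"
        "pathstart q = pathstart p" "pathfinish q = pathfinish p" for p q
      using K(1) that unfolding simply_connected_eq_homotopic_paths by blast
    have "path_image (w +++ t +++ reversepath r) \<subseteq> ?K"
      using im by (intro subset_path_image_join) auto
    then show ?thesis
      using im by (intro all) (auto simp: defs simp del: path_image_linepath)
  qed
  from homotopic_paths_continuous_image[OF this h]
  have sides: "homotopic_paths X (h \<circ> b) ((h \<circ> w) +++ (h \<circ> t) +++ reversepath (h \<circ> r))"
    by (simp add: path_compose_join path_compose_reversepath)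
  have wr: "homotopic_paths X (h \<circ> w) (h \<circ> r)"
  proof (rule homotopic_paths_eq)
    show "path (h \<circ> w)"
      using h im by (metis continuous_on_subset path_continuous_image w_def path_linepath)
    show "path_image (h \<circ> w) \<subseteq> X"
      using h im by (auto simp: path_image_compose)
    show "(h \<circ> w) x = (h \<circ> r) x" if "x \<in> {0..1}" for x
      using that ends[of x] by (simp add: defs linepath_def)
  qed
  have tc: "homotopic_paths X (h \<circ> t) (\<lambda>_. a)"
  proof (rule homotopic_paths_eq)
    show "path (h \<circ> t)"
      using h im by (metis continuous_on_subset path_continuous_image t_def path_linepath)
    show "path_image (h \<circ> t) \<subseteq> X"
      using h im by (auto simp: path_image_compose)
    show "(h \<circ> t) x = a" if "x \<in> {0..1}" for x
      using that h1[of x] by (simp add: defs linepath_def)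
  qed
  have bp: "homotopic_paths X p (h \<circ> b)"
  proof (rule homotopic_paths_eq)
    show "path p" "path_image p \<subseteq> X"
      using assms homotopic_loops_imp_path homotopic_loops_imp_subset by blast+
    show "p x = (h \<circ> b) x" if "x \<in> {0..1}" for x
      using that h0[of x] by (simp add: defs linepath_def)
  qed
  have w: "path (h \<circ> w)" "path_image (h \<circ> w) \<subseteq> X"
    using wr homotopic_paths_imp_path homotopic_paths_imp_subset by blast+
  have fin: "pathfinish (h \<circ> w) = a" and st: "pathstart (h \<circ> w) = pathstart p"
    using h0[of 0] h1[of 0] by (simp_all add: defs linepath_def pathfinish_def pathstart_def)
  have "homotopic_paths X ((h \<circ> t) +++ reversepath (h \<circ> r)) ((h \<circ> t) +++ reversepath (h \<circ> w))"
    using tc homotopic_paths_imp_path[OF tc] homotopic_paths_imp_subset[OF tc]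
      homotopic_paths_reversepath_D[OF homotopic_paths_sym[OF wr]]
    by (intro homotopic_paths_join) (auto simp: defs pathstart_compose pathfinish_compose)
  then have "homotopic_paths X ((h \<circ> w) +++ (h \<circ> t) +++ reversepath (h \<circ> r)) (lasso (h \<circ> w, h \<circ> t))"
    using w by (auto simp: lasso_def defs pathstart_compose pathfinish_compose intro!: homotopic_paths_join)
  moreover have "homotopic_paths X (lasso (h \<circ> w, h \<circ> t)) (\<lambda>_. pathstart p)"
    using homotopic_lasso_const[OF w, of "h \<circ> t"] tc by (simp add: fin st)
  ultimately show ?thesis
    using bp sides by (blast intro: homotopic_paths_trans)
qed

section \<open>Semilocal simple connectivity\<close>

text \<open>
  For \<open>U \<subseteq> X\<close> and \<open>x \<in> U\<close> this is triviality of the inclusion-induced homomorphism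
  \<open>\<pi>\<^sub>1(U, x) \<rightarrow> \<pi>\<^sub>1(X, x)\<close>, expressed by paths; for a point \<open>x\<close> outside \<open>U\<close> it holds vacuously, which allows
  quantification over all points below.
\<close>

definition inessential_at :: "'a::topological_space set \<Rightarrow> 'a set \<Rightarrow> 'a \<Rightarrow> bool" where
  "inessential_at X U x \<longleftrightarrow> (\<forall>p. loop_at U x p \<longrightarrow> homotopic_paths X p (\<lambda>_. x))"

lemma inessential_atD:
  "inessential_at X U x \<Longrightarrow> loop_at U x p \<Longrightarrow> homotopic_paths X p (\<lambda>_. x)"
  by (simp add: inessential_at_def)

lemma inessential_at_subset: "inessential_at X U x \<Longrightarrow> V \<subseteq> U \<Longrightarrow> inessential_at X V x"
  by (auto simp: inessential_at_def loop_at_def)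

lemma inessential_at_outside: "x \<notin> U \<Longrightarrow> inessential_at X U x"
  using pathstart_in_path_image by (fastforce simp: inessential_at_def loop_at_def)

lemma path_class_eq_one_iff:
  assumes "path p" "path_image p \<subseteq> X"
  shows "path_class X p = \<one>\<^bsub>fundamental_group X x\<^esub> \<longleftrightarrow> homotopic_paths X p (\<lambda>_. x)"
  using path_class_eq_iff[OF assms] by (simp add: fundamental_group_def)

text \<open>
  A loop that contracts freely also contracts relative to its base point, so both notions of
  semilocal simple connectivity can be stated with homotopies that fix the end points.
\<close>

lemma homotopic_loops_const_iff:
  assumes "loop_at X y p"
  shows "(\<exists>a. homotopic_loops X p (\<lambda>_. a)) \<longleftrightarrow> homotopic_paths X p (\<lambda>_. y)"
proof
  assume "\<exists>a. homotopic_loops X p (\<lambda>_. a)"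
  then show "homotopic_paths X p (\<lambda>_. y)"
    using homotopic_loops_const_imp_homotopic_paths assms by (metis loop_at_def)
next
  assume "homotopic_paths X p (\<lambda>_. y)"
  moreover have "pathfinish (\<lambda>_::real. y) = y"
    by (simp only: pathfinish_def)
  ultimately show "\<exists>a. homotopic_loops X p (\<lambda>_. a)"
    using assms homotopic_paths_imp_homotopic_loops[of X p "\<lambda>_. y"] by (auto simp: loop_at_def)
qed

lemma unbased_semilocally_simply_connected_iff:
  "unbased_semilocally_simply_connected X \<longleftrightarrow>
    (\<forall>x\<in>X. \<exists>W. openin (top_of_set X) W \<and> x \<in> W \<and> (\<forall>y. inessential_at X W y))"
proof -
  have free: "(\<forall>y\<in>U. \<forall>p. loop_at U y p \<longrightarrow> (\<exists>a. homotopic_loops X p (\<lambda>_. a))) \<longleftrightarrow>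
      (\<forall>y. inessential_at X U y)" if "U \<subseteq> X" for U
  proof -
    have "(\<exists>a. homotopic_loops X p (\<lambda>_. a)) \<longleftrightarrow> homotopic_paths X p (\<lambda>_. y)"
      if "loop_at U y p" for y p
      using that \<open>U \<subseteq> X\<close> by (intro homotopic_loops_const_iff) (auto simp: loop_at_def)
    then have "(\<forall>y\<in>U. \<forall>p. loop_at U y p \<longrightarrow> (\<exists>a. homotopic_loops X p (\<lambda>_. a))) \<longleftrightarrow>
        (\<forall>y\<in>U. inessential_at X U y)"
      by (simp add: inessential_at_def)
    then show ?thesis
      using inessential_at_outside[of _ U X] by blast
  qed
  have "(\<exists>U. nbhd_in X x U \<and> (\<forall>y\<in>U. \<forall>p. loop_at U y p \<longrightarrow> (\<exists>a. homotopic_loops X p (\<lambda>_. a)))) \<longleftrightarrow>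
      (\<exists>U. nbhd_in X x U \<and> (\<forall>y. inessential_at X U y))" for x
    using free unfolding nbhd_in_def by (intro ex_cong1 conj_cong refl) simp
  also have "\<dots> x \<longleftrightarrow>
      (\<exists>W. openin (top_of_set X) W \<and> x \<in> W \<and> (\<forall>y. inessential_at X W y))" for x
  proof
    assume "\<exists>U. nbhd_in X x U \<and> (\<forall>y. inessential_at X U y)"
    then obtain U W where "openin (top_of_set X) W" "x \<in> W" "W \<subseteq> U" "\<forall>y. inessential_at X U y"
      unfolding nbhd_in_def by auto
    then show "\<exists>W. openin (top_of_set X) W \<and> x \<in> W \<and> (\<forall>y. inessential_at X W y)"
      using inessential_at_subset[of X U _ W] by (intro exI[of _ W]) simp
  next
    assume "\<exists>W. openin (top_of_set X) W \<and> x \<in> W \<and> (\<forall>y. inessential_at X W y)"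
    then show "\<exists>U. nbhd_in X x U \<and> (\<forall>y. inessential_at X U y)"
      unfolding nbhd_in_def by (metis openin_imp_subset order_refl)
  qed
  finally show ?thesis
    unfolding unbased_semilocally_simply_connected_def by simp
qed

lemma semilocally_simply_connected_iff:
  "semilocally_simply_connected X \<longleftrightarrow>
    (\<forall>x\<in>X. \<exists>W. openin (top_of_set X) W \<and> x \<in> W \<and> inessential_at X W x)"
proof -
  have triv: "trivial_homomorphism (fundamental_group U x) (fundamental_group X x) (inclusion_induced X) \<longleftrightarrow>
      inessential_at X U x" if "U \<subseteq> X" for U x
  proof -
    have "inclusion_induced X (path_class U p) = \<one>\<^bsub>fundamental_group X x\<^esub> \<longleftrightarrow> homotopic_paths X p (\<lambda>_. x)"
      if p: "loop_at U x p" for p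
      unfolding inclusion_induced_path_class[OF p \<open>U \<subseteq> X\<close>]
      using p \<open>U \<subseteq> X\<close> by (intro path_class_eq_one_iff) (auto simp: loop_at_def)
    then show ?thesis
      using inclusion_induced_hom[OF that]
      unfolding trivial_homomorphism_def inessential_at_def by (auto simp: fundamental_group_def)
  qed
  have "(\<exists>U. nbhd_in X x U \<and> trivial_homomorphism (fundamental_group U x) (fundamental_group X x)
      (inclusion_induced X)) \<longleftrightarrow> (\<exists>U. nbhd_in X x U \<and> inessential_at X U x)" for x
    using triv unfolding nbhd_in_def by (intro ex_cong1 conj_cong refl) simp
  also have "\<dots> x \<longleftrightarrow> (\<exists>W. openin (top_of_set X) W \<and> x \<in> W \<and> inessential_at X W x)" for x
  proof
    assume "\<exists>U. nbhd_in X x U \<and> inessential_at X U x"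
    then obtain U W where "openin (top_of_set X) W" "x \<in> W" "W \<subseteq> U" "inessential_at X U x"
      unfolding nbhd_in_def by auto
    then show "\<exists>W. openin (top_of_set X) W \<and> x \<in> W \<and> inessential_at X W x"
      using inessential_at_subset by (intro exI[of _ W]) auto
  next
    assume "\<exists>W. openin (top_of_set X) W \<and> x \<in> W \<and> inessential_at X W x"
    then show "\<exists>U. nbhd_in X x U \<and> inessential_at X U x"
      unfolding nbhd_in_def by (metis openin_imp_subset order_refl)
  qed
  finally show ?thesis
    unfolding semilocally_simply_connected_def by simp
qed

section \<open>Trivial Spanier groups\<close>

lemma homotopic_path_prod_const:
  assumes "x \<in> X" and "\<And>p. p \<in> set ps \<Longrightarrow> homotopic_paths X p (\<lambda>_. x)"
  shows "homotopic_paths X (path_prod x ps) (\<lambda>_. x)"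
proof -
  have const: "homotopic_paths X (\<lambda>_. x) (\<lambda>_. x)"
    using assms(1) by (auto simp: path_def path_image_def)
  have ends: "pathstart p = x \<and> pathfinish p = x" if "homotopic_paths X p (\<lambda>_. x)" for p
    using homotopic_paths_imp_pathstart[OF that] homotopic_paths_imp_pathfinish[OF that]
    by (simp add: pathstart_def pathfinish_def)
  show ?thesis
    using assms(2)
  proof (induction ps rule: induct_list012)
    case (3 p q ps)
    then have p: "homotopic_paths X p (\<lambda>_. x)" and rest: "homotopic_paths X (path_prod x (q # ps)) (\<lambda>_. x)"
      by auto
    have "homotopic_paths X (p +++ path_prod x (q # ps)) ((\<lambda>_. x) +++ (\<lambda>_. x))"
      using p rest ends[OF p] ends[OF rest] by (intro homotopic_paths_join) auto
    moreover have "(\<lambda>_. x) +++ (\<lambda>_. x) = (\<lambda>_. x)"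
      by (simp add: joinpaths_def)
    ultimately show ?case
      by simp
  qed (use const in auto)
qed

text \<open>
  Both Spanier groups consist of the classes of products of lassos whose tail and loop satisfy some
  condition \<open>P\<close>.  Products of null-homotopic loops are null-homotopic, so only products with a single
  factor matter, and the empty product contributes the neutral element.
\<close>

lemma lasso_classes_trivial_iff:
  assumes "x0 \<in> X"
    and P: "\<And>u v. P u v \<Longrightarrow> path u \<and> path_image u \<subseteq> X \<and> pathstart u = x0 \<and> loop_at X (pathfinish u) v"
  shows "{path_class X (path_prod x0 (map lasso uvs)) | uvs. \<forall>(u, v)\<in>set uvs. P u v} =
      {\<one>\<^bsub>fundamental_group X x0\<^esub>} \<longleftrightarrow>
    (\<forall>u v. P u v \<longrightarrow> homotopic_paths X v (\<lambda>_. pathfinish u))" (is "?G = {?one} \<longleftrightarrow> ?R")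
proof
  assume G: "?G = {?one}"
  show ?R
  proof (intro allI impI)
    fix u v assume uv: "P u v"
    note u = P[OF uv]
    then have "path (lasso (u, v))" "path_image (lasso (u, v)) \<subseteq> X"
      by (auto simp: lasso_def loop_at_def subset_path_image_join)
    moreover have "path_class X (path_prod x0 (map lasso [(u, v)])) \<in> ?G"
      using uv by (intro CollectI exI[of _ "[(u, v)]"]) auto
    then have "path_class X (lasso (u, v)) = ?one"
      unfolding G by simp
    ultimately show "homotopic_paths X v (\<lambda>_. pathfinish u)"
      using u homotopic_lasso_const_iff path_class_eq_one_iff by metis
  qed
next
  assume R: ?R
  have "path_class X (path_prod x0 (map lasso uvs)) = ?one" if uvs: "\<forall>(u, v)\<in>set uvs. P u v" for uvs
  proof -
    have "homotopic_paths X (path_prod x0 (map lasso uvs)) (\<lambda>_. x0)"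
    proof (rule homotopic_path_prod_const[OF \<open>x0 \<in> X\<close>])
      fix p assume "p \<in> set (map lasso uvs)"
      then obtain u v where "(u, v) \<in> set uvs" "p = lasso (u, v)"
        by auto
      moreover from this have "P u v"
        using uvs by blast
      ultimately show "homotopic_paths X p (\<lambda>_. x0)"
        using P R homotopic_lasso_const by metis
    qed
    then show ?thesis
      using path_class_eq_one_iff homotopic_paths_imp_path homotopic_paths_imp_subset by metis
  qed
  moreover have "?one \<in> ?G"
    by (intro CollectI exI[of _ "[]"]) (simp add: fundamental_group_def)
  ultimately show "?G = {?one}"
    by blast
qed

lemma path_connected_path_from:
  assumes "path_connected X" "x \<in> X" "y \<in> X"
  obtains u where "path u" "path_image u \<subseteq> X" "pathstart u = x" "pathfinish u = y"
  using assms unfolding path_connected_def by blast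

text \<open>
  The tails disappear from the condition, because a path-connected space has a tail from \<open>x0\<close> to
  every point.
\<close>

lemma unbased_spanier_group_trivial_iff:
  assumes X: "path_connected X" "x0 \<in> X" and \<U>: "open_covering X \<U>"
  shows "unbased_spanier_group X \<U> x0 = {\<one>\<^bsub>fundamental_group X x0\<^esub>} \<longleftrightarrow>
    (\<forall>U\<in>\<U>. \<forall>y. inessential_at X U y)" (is "_ \<longleftrightarrow> ?R")
proof -
  have sub: "U \<subseteq> X" if "U \<in> \<U>" for U
    using \<U> that by (auto simp: open_covering_def)
  define P where "P u v \<longleftrightarrow> path u \<and> path_image u \<subseteq> X \<and> pathstart u = x0 \<and>
    (\<exists>U\<in>\<U>. loop_at U (pathfinish u) v)" for u v
  have "unbased_spanier_group X \<U> x0 = {\<one>\<^bsub>fundamental_group X x0\<^esub>} \<longleftrightarrow>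
      (\<forall>u v. P u v \<longrightarrow> homotopic_paths X v (\<lambda>_. pathfinish u))"
    unfolding unbased_spanier_group_def P_def[symmetric]
  proof (rule lasso_classes_trivial_iff[OF X(2)])
    show "path u \<and> path_image u \<subseteq> X \<and> pathstart u = x0 \<and> loop_at X (pathfinish u) v"
      if "P u v" for u v
    proof -
      from that obtain U where "loop_at U (pathfinish u) v" "U \<subseteq> X"
        using sub unfolding P_def by blast
      with that show ?thesis
        by (auto simp: P_def loop_at_def)
    qed
  qed
  also have "\<dots> \<longleftrightarrow> ?R"
  proof
    assume L: "\<forall>u v. P u v \<longrightarrow> homotopic_paths X v (\<lambda>_. pathfinish u)"
    show ?R
      unfolding inessential_at_def
    proof (intro ballI allI impI)
      fix U y v assume U: "U \<in> \<U>" and v: "loop_at U y v"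
      then have "y \<in> X"
        using sub pathstart_in_path_image by (fastforce simp: loop_at_def)
      then obtain u where "path u" "path_image u \<subseteq> X" "pathstart u = x0" "pathfinish u = y"
        using path_connected_path_from X by metis
      with L U v show "homotopic_paths X v (\<lambda>_. y)"
        unfolding P_def by blast
    qed
  qed (auto simp: P_def inessential_at_def)
  finally show ?thesis .
qed

lemma based_spanier_group_trivial_iff:
  assumes X: "path_connected X" "x0 \<in> X" and \<V>: "pointed_open_covering X \<V>"
  shows "based_spanier_group X \<V> x0 = {\<one>\<^bsub>fundamental_group X x0\<^esub>} \<longleftrightarrow>
    (\<forall>(U, x)\<in>\<V>. inessential_at X U x)" (is "_ \<longleftrightarrow> ?R")
proof -
  have sub: "U \<subseteq> X" "x \<in> X" if "(U, x) \<in> \<V>" for U x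
    using \<V> that openin_subset by (fastforce simp: pointed_open_covering_def)+
  define P where "P u v \<longleftrightarrow> path u \<and> path_image u \<subseteq> X \<and> pathstart u = x0 \<and>
    (\<exists>(U, x)\<in>\<V>. pathfinish u = x \<and> loop_at U x v)" for u v
  have "based_spanier_group X \<V> x0 = {\<one>\<^bsub>fundamental_group X x0\<^esub>} \<longleftrightarrow>
      (\<forall>u v. P u v \<longrightarrow> homotopic_paths X v (\<lambda>_. pathfinish u))"
    unfolding based_spanier_group_def P_def[symmetric]
  proof (rule lasso_classes_trivial_iff[OF X(2)])
    show "path u \<and> path_image u \<subseteq> X \<and> pathstart u = x0 \<and> loop_at X (pathfinish u) v"
      if "P u v" for u v
    proof -
      from that obtain U where "loop_at U (pathfinish u) v" "U \<subseteq> X"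
        using sub unfolding P_def by blast
      with that show ?thesis
        by (auto simp: P_def loop_at_def)
    qed
  qed
  also have "\<dots> \<longleftrightarrow> ?R"
  proof
    assume L: "\<forall>u v. P u v \<longrightarrow> homotopic_paths X v (\<lambda>_. pathfinish u)"
    show ?R
      unfolding inessential_at_def
    proof (clarify)
      fix U x v assume U: "(U, x) \<in> \<V>" and v: "loop_at U x v"
      obtain u where "path u" "path_image u \<subseteq> X" "pathstart u = x0" "pathfinish u = x"
        using path_connected_path_from X sub(2)[OF U] by metis
      with L U v show "homotopic_paths X v (\<lambda>_. x)"
        unfolding P_def by blast
    qed
  qed (auto simp: P_def inessential_at_def)
  finally show ?thesis .
qed

text \<open>
  The largest candidate for the covering, all open sets whose loops die in \<open>X\<close>, covers \<open>X\<close> exactly if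
  every point has a small neighbourhood.
\<close>

lemma unbased_semilocally_simply_connected_iff_spanier:
  assumes X: "path_connected X" "x0 \<in> X"
  shows "unbased_semilocally_simply_connected X \<longleftrightarrow>
    (\<exists>\<U>. open_covering X \<U> \<and> unbased_spanier_group X \<U> x0 = {\<one>\<^bsub>fundamental_group X x0\<^esub>})"
    (is "?L \<longleftrightarrow> ?R")
proof
  assume L: ?L
  define \<U> where "\<U> = {W. openin (top_of_set X) W \<and>
    (\<forall>y. inessential_at X W y)}"
  have "X \<subseteq> \<Union>\<U>"
  proof
    fix x assume "x \<in> X"
    with L obtain W where "W \<in> \<U>" "x \<in> W"
      unfolding unbased_semilocally_simply_connected_iff \<U>_def by auto
    then show "x \<in> \<Union>\<U>"
      by blast
  qed
  moreover have "\<Union>\<U> \<subseteq> X"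
    using openin_subset unfolding \<U>_def by fastforce
  ultimately have cov: "open_covering X \<U>"
    by (auto simp: open_covering_def \<U>_def)
  have "unbased_spanier_group X \<U> x0 = {\<one>\<^bsub>fundamental_group X x0\<^esub>}"
    unfolding unbased_spanier_group_trivial_iff[OF X cov] by (auto simp: \<U>_def)
  with cov show ?R
    by blast
next
  assume ?R
  then obtain \<U> where \<U>: "open_covering X \<U>"
    and "unbased_spanier_group X \<U> x0 = {\<one>\<^bsub>fundamental_group X x0\<^esub>}"
    by blast
  then have "\<forall>U\<in>\<U>. \<forall>y. inessential_at X U y"
    by (simp add: unbased_spanier_group_trivial_iff[OF X])
  with \<U> show ?L
    unfolding unbased_semilocally_simply_connected_iff open_covering_def by blast
qed

text \<open>
  A covering by pointed sets may use different open sets at different points, so it can record for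
  every \<open>x\<close> a neighbourhood that is good for loops at \<open>x\<close> only.
\<close>

lemma semilocally_simply_connected_iff_spanier:
  assumes X: "path_connected X" "x0 \<in> X"
  shows "semilocally_simply_connected X \<longleftrightarrow>
    (\<exists>\<V>. pointed_open_covering X \<V> \<and> based_spanier_group X \<V> x0 = {\<one>\<^bsub>fundamental_group X x0\<^esub>})"
    (is "?L \<longleftrightarrow> ?R")
proof
  assume L: ?L
  define \<V> where "\<V> = {(W, x). openin (top_of_set X) W \<and> x \<in> W \<and>
    inessential_at X W x}"
  have "X \<subseteq> snd ` \<V>"
  proof
    fix x assume "x \<in> X"
    with L obtain W where "(W, x) \<in> \<V>"
      unfolding semilocally_simply_connected_iff \<V>_def by auto
    then show "x \<in> snd ` \<V>"
      by force
  qed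
  moreover have "snd ` \<V> \<subseteq> X"
    using openin_subset unfolding \<V>_def by fastforce
  ultimately have cov: "pointed_open_covering X \<V>"
    by (auto simp: pointed_open_covering_def \<V>_def)
  have "based_spanier_group X \<V> x0 = {\<one>\<^bsub>fundamental_group X x0\<^esub>}"
    unfolding based_spanier_group_trivial_iff[OF X cov] by (simp add: \<V>_def)
  with cov show ?R
    by blast
next
  assume ?R
  then obtain \<V> where \<V>: "pointed_open_covering X \<V>"
    and "based_spanier_group X \<V> x0 = {\<one>\<^bsub>fundamental_group X x0\<^esub>}"
    by blast
  then have null: "\<forall>(U, x)\<in>\<V>. inessential_at X U x"
    by (simp add: based_spanier_group_trivial_iff[OF X])
  show ?L
    unfolding semilocally_simply_connected_iff
  proof
    fix x assume "x \<in> X"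
    then obtain U where "(U, x) \<in> \<V>"
      using \<V> by (auto simp: pointed_open_covering_def)
    with \<V> null show "\<exists>W. openin (top_of_set X) W \<and> x \<in> W \<and>
        inessential_at X W x"
      unfolding pointed_open_covering_def by blast
  qed
qed

lemma unbased_imp_based_semilocally_simply_connected:
  "unbased_semilocally_simply_connected X \<Longrightarrow> semilocally_simply_connected X"
  unfolding unbased_semilocally_simply_connected_iff semilocally_simply_connected_iff by meson

text \<open>
  A loop \<open>v\<close> at a point \<open>y\<close> near \<open>x\<close> becomes a loop at \<open>x\<close> after adding a tail from \<open>x\<close> to \<open>y\<close>.  Local
  path-connectedness is what keeps the tail, and hence the lasso, inside the neighbourhood of \<open>x\<close>.
\<close>

lemma based_imp_unbased_semilocally_simply_connected:
  assumes lpc: "locally path_connected X" and "semilocally_simply_connected X"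
  shows "unbased_semilocally_simply_connected X"
  unfolding unbased_semilocally_simply_connected_iff
proof
  fix x assume "x \<in> X"
  then obtain W where W: "openin (top_of_set X) W" "x \<in> W"
    and W_iness: "inessential_at X W x"
    using assms(2) unfolding semilocally_simply_connected_iff by blast
  obtain U V where UV: "openin (top_of_set X) U" "path_connected V" "x \<in> U" "U \<subseteq> V" "V \<subseteq> W"
    using locallyE[OF lpc W] by metis
  have "W \<subseteq> X"
    using W(1) openin_subset by fastforce
  have "homotopic_paths X v (\<lambda>_. y)" if v: "loop_at U y v" for y v
  proof -
    have "y \<in> V"
      using v UV(4) pathstart_in_path_image by (fastforce simp: loop_at_def)
    then obtain u where u: "path u" "path_image u \<subseteq> V" "pathstart u = x" "pathfinish u = y"
      using path_connected_path_from UV(2-4) by (metis subsetD)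
    have "path_image u \<subseteq> W" "path_image v \<subseteq> W"
      using u v UV(4,5) by (auto simp: loop_at_def)
    then have "loop_at W x (lasso (u, v))"
      using u v by (auto simp: lasso_def loop_at_def subset_path_image_join)
    from inessential_atD[OF W_iness this] show ?thesis
      using homotopic_lasso_const_iff[of u X v] u v UV(4,5) \<open>W \<subseteq> X\<close>
      by (auto simp: loop_at_def)
  qed
  with UV(1,3) show "\<exists>W. openin (top_of_set X) W \<and> x \<in> W \<and>
      (\<forall>y. inessential_at X W y)"
    unfolding inessential_at_def by blast
qed

section \<open>The rotated sine curve\<close>

definition horizontal :: "real^3 \<Rightarrow> complex" where
  "horizontal p = Complex (p$1) (p$2)"

definition sine_graph :: "complex \<Rightarrow> real^3" where
  "sine_graph w = vector [Re w, Im w, sin (1 / cmod w)]"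

lemma continuous_on_vector_3 [continuous_intros]:
  fixes f g h :: "'a::topological_space \<Rightarrow> real"
  assumes "continuous_on S f" "continuous_on S g" "continuous_on S h"
  shows "continuous_on S (\<lambda>x. vector [f x, g x, h x] :: real^3)"
proof -
  have "vector [f x, g x, h x] = (\<chi> i::3. if i = 1 then f x else if i = 2 then g x else h x)" for x
    by (simp add: vec_eq_iff forall_3)
  moreover have "continuous_on S (\<lambda>x. \<chi> i::3. if i = 1 then f x else if i = 2 then g x else h x)"
  proof (intro continuous_on_vec_lambda)
    show "continuous_on S (\<lambda>x. if i = 1 then f x else if i = 2 then g x else h x)" for i :: 3
      using assms by (cases "i = 1"; cases "i = 2") simp_all
  qed
  ultimately show ?thesis
    by simp
qed

lemma continuous_on_horizontal [continuous_intros]: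
  "continuous_on S f \<Longrightarrow> continuous_on S (\<lambda>x. horizontal (f x))"
  unfolding horizontal_def Complex_eq by (intro continuous_intros)

lemma continuous_on_sine_graph: "0 \<notin> S \<Longrightarrow> continuous_on S sine_graph"
  unfolding sine_graph_def by (intro continuous_intros) auto

lemma horizontal_sine_graph [simp]: "horizontal (sine_graph w) = w"
  by (simp add: horizontal_def sine_graph_def)

text \<open>
  A graph is recovered from its projection to the plane, so all questions about the surface alone
  become questions about the punctured unit disc in the complex plane.
\<close>

lemma sine_surface_eq_image: "sine_surface = sine_graph ` (cball 0 1 - {0})"
proof (intro equalityI subsetI)
  fix p assume "p \<in> sine_surface"
  then obtain r \<phi> where r: "p = vector [r * cos \<phi>, r * sin \<phi>, sin (1 / r)]" "0 < r" "r \<le> 1"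
    unfolding sine_surface_def by auto
  then have "p = sine_graph (rcis r \<phi>)" "rcis r \<phi> \<in> cball 0 1 - {0}"
    by (auto simp: sine_graph_def)
  then show "p \<in> sine_graph ` (cball 0 1 - {0})"
    by blast
next
  fix p assume "p \<in> sine_graph ` (cball 0 1 - {0})"
  then obtain w where "p = sine_graph w" "w \<in> cball 0 1 - {0}"
    by blast
  then have w: "p = sine_graph w" "0 < cmod w" "cmod w \<le> 1"
    by auto
  define \<phi> where "\<phi> = Arg2pi w"
  have "w = of_real (cmod w) * exp (\<i> * of_real \<phi>)" "0 \<le> \<phi>" "\<phi> \<le> 2 * pi"
    using Arg2pi[of w] unfolding \<phi>_def is_Arg_def by auto
  then have "Re w = cmod w * cos \<phi>" "Im w = cmod w * sin \<phi>"
    by (metis Re_complex_of_real cis.simps cis_conv_exp rcis_def Re_rcis Im_rcis)+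
  then have "p = vector [cmod w * cos \<phi>, cmod w * sin \<phi>, sin (1 / cmod w)]"
    using w(1) by (simp add: sine_graph_def)
  then show "p \<in> sine_surface"
    unfolding sine_surface_def using w \<open>0 \<le> \<phi>\<close> \<open>\<phi> \<le> 2 * pi\<close> by blast
qed

lemma mem_sine_surface_iff:
  "p \<in> sine_surface \<longleftrightarrow> horizontal p \<noteq> 0 \<and> cmod (horizontal p) \<le> 1 \<and> p$3 = sin (1 / cmod (horizontal p))"
proof -
  have "p = sine_graph (horizontal p) \<longleftrightarrow> p$3 = sin (1 / cmod (horizontal p))"
    by (simp add: vec_eq_iff forall_3 sine_graph_def horizontal_def)
  moreover have "p \<in> sine_surface \<longleftrightarrow> horizontal p \<in> cball 0 1 - {0} \<and> p = sine_graph (horizontal p)"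
    unfolding sine_surface_eq_image by force
  ultimately show ?thesis
    by auto
qed

lemma mem_central_axis_iff: "p \<in> central_axis \<longleftrightarrow> horizontal p = 0 \<and> \<bar>p$3\<bar> \<le> 1"
  by (auto simp: central_axis_def horizontal_def vec_eq_iff forall_3 complex_eq_iff abs_le_iff)

lemma convex_central_axis: "convex central_axis"
proof -
  have lin: "linear (\<lambda>z. vector [0, 0, z] :: real^3)"
    by (rule linearI) (simp_all add: vec_eq_iff forall_3)
  have "central_axis = (\<lambda>z. vector [0, 0, z]) ` {-1..1}"
    by (auto simp: central_axis_def)
  then show ?thesis
    using convex_linear_image[OF lin convex_closed_interval] by metis
qed

text \<open>
  Off the axis the height condition is given by a function that is continuous there.  On the axis
  only the bound \<open>1\<close> on the height remains, and points above or below it have a neighbourhood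
  that avoids the surface as well.
\<close>

lemma closed_surface_axis: "closed (sine_surface \<union> central_axis)"
proof -
  have sin_bound: "\<not> 1 < \<bar>sin t\<bar>" for t :: real
    by (simp add: not_less)
  define f where "f p = p$3 - sin (1 / cmod (horizontal p))" for p
  have "open {p. horizontal p \<noteq> 0}"
    by (intro open_Collect_neq continuous_intros)
  moreover have "continuous_on {p. horizontal p \<noteq> 0} f"
    unfolding f_def by (intro continuous_intros) auto
  ultimately have "open ({p. horizontal p \<noteq> 0} \<inter> f -` (- {0}))"
    by (intro continuous_open_preimage) auto
  then have "open ({p. cmod (horizontal p) > 1} \<union> {p::real^3. \<bar>p$3\<bar> > 1} \<union> ({p. horizontal p \<noteq> 0} \<inter> f -` (- {0})))"
    by (intro open_Un open_Collect_less continuous_intros)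
  moreover have "- (sine_surface \<union> central_axis) =
      {p. cmod (horizontal p) > 1} \<union> {p. \<bar>p$3\<bar> > 1} \<union> ({p. horizontal p \<noteq> 0} \<inter> f -` (- {0}))"
    by (auto simp: mem_sine_surface_iff mem_central_axis_iff f_def not_le sin_bound)
  ultimately show ?thesis
    by (simp add: closed_def)
qed

lemma closed_central_axis: "closed central_axis"
proof -
  have "central_axis = {p. horizontal p = 0} \<inter> {p. \<bar>p$3\<bar> \<le> 1}"
    by (auto simp: mem_central_axis_iff)
  also have "closed \<dots>"
    by (intro closed_Int closed_Collect_eq closed_Collect_le continuous_intros)
  finally show ?thesis .
qed

lemma surface_axis_disjoint: "sine_surface \<inter> central_axis = {}"
  by (auto simp: mem_sine_surface_iff mem_central_axis_iff)

lemma path_connected_sine_surface: "path_connected sine_surface"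
proof -
  define f :: "real \<times> real \<Rightarrow> real^3"
    where "f = (\<lambda>(r, \<phi>). vector [r * cos \<phi>, r * sin \<phi>, sin (1 / r)])"
  have "sine_surface = f ` ({0<..1} \<times> {0..2 * pi})"
    unfolding sine_surface_def f_def by force
  moreover have "continuous_on ({0<..1} \<times> {0..2 * pi}) f"
    unfolding f_def case_prod_unfold by (intro continuous_intros) auto
  ultimately show ?thesis
    by (metis path_connected_continuous_image convex_imp_path_connected convex_Times convex_real_interval)
qed

text \<open>
  The closed disc around the projection of \<open>x\<close> has half the radius that would reach the axis, so the
  patch is compact and the graph is continuous on it; the intersection with the unit disc, which matters
  when \<open>x\<close> is close to the rim, keeps it inside the surface and is still convex.
\<close>

definition surface_patch :: "real^3 \<Rightarrow> (real^3) set" where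
  "surface_patch x = sine_graph ` (cball (horizontal x) (cmod (horizontal x) / 2) \<inter> cball 0 1)"

lemma zero_notin_half_ball:
  fixes w :: complex
  assumes "w \<noteq> 0"
  shows "0 \<notin> cball w (cmod w / 2) \<inter> cball 0 1"
  using assms by (auto simp: dist_norm)

lemma surface_patch_subset: "x \<in> sine_surface \<Longrightarrow> surface_patch x \<subseteq> sine_surface"
  using zero_notin_half_ball[of "horizontal x"]
  unfolding sine_surface_eq_image[of] surface_patch_def mem_sine_surface_iff
  by (intro image_mono) (auto simp: dist_norm)

lemma in_surface_patch:
  assumes "p \<in> sine_surface" "cmod (horizontal p - horizontal x) \<le> cmod (horizontal x) / 2"
  shows "p \<in> surface_patch x"
proof -
  have "p = sine_graph (horizontal p)"
    using assms by (simp add: vec_eq_iff forall_3 sine_graph_def horizontal_def mem_sine_surface_iff)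
  then show ?thesis
    using assms unfolding surface_patch_def
    by (intro image_eqI[of _ _ "horizontal p"]) (auto simp: dist_norm norm_minus_commute mem_sine_surface_iff)
qed

text \<open>
  The patch is homeomorphic to a compact convex set.  Being an absolute retract is recorded because
  this property, unlike simple connectedness, passes to a union of two closed sets whose
  intersection has it.
\<close>

lemma AR_surface_patch:
  assumes "x \<in> sine_surface"
  shows "AR (surface_patch x)" "compact (surface_patch x)"
proof -
  let ?D = "cball (horizontal x) (cmod (horizontal x) / 2) \<inter> cball 0 1"
  have D: "convex ?D" "compact ?D" "horizontal x \<in> ?D" "continuous_on ?D sine_graph"
    using assms zero_notin_half_ball[of "horizontal x"]
    by (auto simp: convex_Int compact_Int mem_sine_surface_iff continuous_on_sine_graph)
  have "inj_on sine_graph ?D"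
    by (metis horizontal_sine_graph inj_onI)
  then have "?D homeomorphic surface_patch x"
    using D(2,4) unfolding surface_patch_def by (intro homeomorphic_compact) auto
  then show "AR (surface_patch x)"
    using convex_imp_AR[OF D(1)] D(3) homeomorphic_AR_iff_AR by blast
  show "compact (surface_patch x)"
    unfolding surface_patch_def using D by (intro compact_continuous_image)
qed

text \<open>
  A parabola over the \<open>x\<close>-axis from the top of the central axis to the outermost crest of the surface,
  the circle of radius \<open>2 / \<pi>\<close>.  Its interior has height above \<open>1\<close> and so misses the surface and the axis.
\<close>

lemma connecting_arc_exists: "\<exists>g. connecting_arc g"
proof
  define g :: "real \<Rightarrow> real^3" where "g t = vector [2 / pi * t, 0, 1 + t * (1 - t)]" for t
  have hor: "horizontal (g t) = of_real (2 / pi * t)" for t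
    by (simp add: horizontal_def g_def complex_eq_iff)
  have g3: "g t $ 3 = 1 + t * (1 - t)" for t
    by (simp add: g_def)
  have "arc g"
  proof -
    have "continuous_on {0..1} g"
      unfolding g_def by (intro continuous_intros)
    moreover have "inj g"
      by (rule injI) (simp add: g_def vec_eq_iff forall_3)
    ultimately show ?thesis
      unfolding arc_def path_def using inj_on_subset by blast
  qed
  have st: "pathstart g \<in> central_axis" 
    by (simp add: pathstart_def mem_central_axis_iff hor g3)
  have fi: "pathfinish g \<in> sine_surface"
    by (simp add: pathfinish_def mem_sine_surface_iff hor g3 norm_divide pi_ge_two[THEN order_trans] divide_le_eq)
  have "t = 0 \<or> t = 1" if "t \<in> {0..1}" "g t \<in> sine_surface \<union> central_axis" for t
  proof -
    have "g t $ 3 \<le> 1"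
      using that(2) by (auto simp: mem_sine_surface_iff mem_central_axis_iff)
    then have "t * (1 - t) \<le> 0"
      by (simp add: g3)
    with that(1) show ?thesis
      by (auto simp: mult_le_0_iff)
  qed
  then have "path_image g \<inter> (sine_surface \<union> central_axis) = {pathstart g, pathfinish g}"
    using st fi unfolding path_image_def pathstart_def pathfinish_def by fastforce
  with \<open>arc g\<close> st fi show "connecting_arc g"
    by (simp add: connecting_arc_def)
qed

section \<open>Paths on the stem and semilocal simple connectivity of the example\<close>

locale arc_on_sine_surface =
  fixes g :: "real \<Rightarrow> real^3"
  assumes connecting_arc: "connecting_arc g"
begin

abbreviation "Y \<equiv> space_Y g"

abbreviation "junction \<equiv> pathfinish g"

definition stem :: "(real^3) set" where
  "stem = central_axis \<union> path_image g"

lemma arc_g: "arc g" and start_in_axis: "pathstart g \<in> central_axis"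
  and junction_in_surface: "junction \<in> sine_surface"
  and arc_meets: "path_image g \<inter> (sine_surface \<union> central_axis) = {pathstart g, junction}"
  using connecting_arc by (auto simp: connecting_arc_def)

lemma space_Y_eq: "Y = sine_surface \<union> stem"
  by (auto simp: space_Y_def stem_def)

lemma stem_Int_surface: "stem \<inter> sine_surface = {junction}"
proof -
  have "central_axis \<inter> sine_surface = {}" "path_image g \<inter> sine_surface \<subseteq> {pathstart g, junction}"
    using arc_meets surface_axis_disjoint by auto
  moreover have "pathstart g \<notin> sine_surface"
    using start_in_axis surface_axis_disjoint by auto
  ultimately show ?thesis
    using junction_in_surface pathfinish_in_path_image unfolding stem_def by auto
qed

lemma axis_Int_arc: "central_axis \<inter> path_image g = {pathstart g}"
proof -
  have "central_axis \<inter> path_image g \<subseteq> {pathstart g, junction}"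
    using arc_meets by auto
  moreover have "junction \<notin> central_axis"
    using junction_in_surface surface_axis_disjoint by auto
  ultimately show ?thesis
    using start_in_axis pathstart_in_path_image by auto
qed

lemma closed_arc: "closed (path_image g)"
  using arc_g closed_arc_image by blast

lemma closed_stem: "closed stem"
  unfolding stem_def using closed_arc closed_central_axis by blast

lemma AR_arc: "AR (path_image g)"
proof -
  have "path_image g homeomorphic {0..1::real}"
    using arc_g by (intro homeomorphic_arc_image_interval) auto
  moreover have "AR {0..1::real}"
    by (intro convex_imp_AR) auto
  ultimately show ?thesis
    using homeomorphic_AR_iff_AR by blast
qed

text \<open>
  Two absolute retracts glued at a point form an absolute retract, hence a contractible space.
\<close>

lemma simply_connected_stem: "simply_connected stem"
proof -
  have "AR central_axis"
    using start_in_axis convex_central_axis by (intro convex_imp_AR) auto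
  then have "AR stem"
    unfolding stem_def using closed_central_axis closed_arc AR_arc
    by (intro AR_closed_Un) (auto simp: axis_Int_arc convex_imp_AR)
  then show ?thesis
    by (intro contractible_imp_simply_connected AR_imp_contractible)
qed

lemma simply_connected_patch_Un_arc: "simply_connected (surface_patch junction \<union> path_image g)"
proof -
  let ?D = "surface_patch junction"
  have "junction \<in> ?D"
    using junction_in_surface by (intro in_surface_patch) auto
  then have "?D \<inter> path_image g = {junction}"
    using surface_patch_subset[OF junction_in_surface] stem_Int_surface
      arc_g pathfinish_in_path_image by (fastforce simp: stem_def)
  then have "AR (?D \<union> path_image g)"
    using AR_surface_patch[OF junction_in_surface] closed_arc AR_arc
    by (intro AR_closed_Un) (auto simp: convex_imp_AR compact_imp_closed)
  then show ?thesis
    by (intro contractible_imp_simply_connected AR_imp_contractible)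
qed

lemma path_connected_space_Y: "path_connected Y"
proof -
  have "path_connected stem"
    unfolding stem_def
  proof (rule path_connected_Un)
    show "path_connected central_axis"
      by (rule convex_imp_path_connected[OF convex_central_axis])
    show "path_connected (path_image g)"
      by (intro path_connected_path_image arc_imp_path arc_g)
    show "central_axis \<inter> path_image g \<noteq> {}"
      by (simp add: axis_Int_arc)
  qed
  then show ?thesis
    unfolding space_Y_eq
    by (rule path_connected_Un[OF path_connected_sine_surface]) (use stem_Int_surface in auto)
qed

text \<open>
  The argument for the topologists' sine curve.  Let \<open>\<rho>\<close> be the distance from the axis on the surface
  and on the axis itself, and \<open>0\<close> on the stem.  Away from the junction these two definitions agree
  where they overlap, and both domains are closed, so \<open>\<rho>\<close> is continuous.  If a connected set contains a point of the stem and
  a point of the surface, then \<open>\<rho>\<close> takes all small positive values on it; among these are radii of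
  crests and troughs, at heights \<open>1\<close> and \<open>-1\<close>, which do not both lie within distance less than \<open>1\<close> of
  the height \<open>z\<close>.
\<close>

lemma flat_connected_subset_stem:
  assumes M: "connected M" "M \<subseteq> Y - {junction}" and flat: "\<And>p. p \<in> M \<Longrightarrow> \<bar>p$3 - z\<bar> < 1"
    and meets: "M \<inter> stem \<noteq> {}"
  shows "M \<subseteq> stem"
proof (rule ccontr)
  assume "\<not> M \<subseteq> stem"
  then obtain q where q: "q \<in> M" "q \<in> sine_surface"
    using M(2) unfolding space_Y_eq by blast
  obtain s where s: "s \<in> M" "s \<in> stem"
    using meets by blast
  define R where "R = M \<inter> (sine_surface \<union> central_axis)"
  define T where "T = M \<inter> stem"
  define \<rho> where "\<rho> p = (if p \<in> sine_surface \<union> central_axis then cmod (horizontal p) else 0)" for p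
  have MRT: "M = R \<union> T"
    using M(2) unfolding R_def T_def space_Y_eq stem_def by blast
  have axis: "p \<in> central_axis" if "p \<in> T" "p \<in> sine_surface \<union> central_axis" for p
    using that M(2) stem_Int_surface unfolding T_def by blast
  have "continuous_on (R \<union> T) \<rho>"
    unfolding \<rho>_def
  proof (rule continuous_on_cases_local)
    show "closedin (top_of_set (R \<union> T)) R" "closedin (top_of_set (R \<union> T)) T"
      unfolding MRT[symmetric] unfolding R_def T_def
      by (intro closedin_closed_Int closed_surface_axis closed_stem)+
    show "continuous_on R (\<lambda>p. cmod (horizontal p))"
      by (intro continuous_intros)
    show "cmod (horizontal p) = 0"
      if "p \<in> R \<and> p \<notin> sine_surface \<union> central_axis \<or> p \<in> T \<and> p \<in> sine_surface \<union> central_axis" for p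
      using that axis by (auto simp: R_def mem_central_axis_iff)
  qed simp
  then have conn: "connected (\<rho> ` M)"
    using M(1) connected_continuous_image by (metis MRT)
  have "\<rho> s = 0"
    using s axis[of s] by (auto simp: \<rho>_def T_def mem_central_axis_iff)
  moreover have "\<rho> q > 0"
    using q by (auto simp: \<rho>_def mem_sine_surface_iff)
  ultimately have sub: "{0..\<rho> q} \<subseteq> \<rho> ` M"
    using connected_contains_Icc[OF conn] s(1) q(1) by (metis imageI)
  have crest: "\<exists>p\<in>M. p$3 = sin t" if t: "t > 0" "1 / t \<le> \<rho> q" for t
  proof -
    have "1 / t \<in> \<rho> ` M"
      using t by (intro subsetD[OF sub]) simp
    then obtain p where p: "p \<in> M" "\<rho> p = 1 / t"
      by auto
    then have "p \<in> sine_surface \<union> central_axis" "cmod (horizontal p) = 1 / t" "horizontal p \<noteq> 0"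
      using t(1) by (auto simp: \<rho>_def split: if_splits)
    then have "p$3 = sin t"
      by (auto simp: mem_sine_surface_iff mem_central_axis_iff)
    with p(1) show ?thesis
      by blast
  qed
  \<comment> \<open>Adding \<open>n\<close> full periods to \<open>\<pi> / 2\<close> or \<open>3 \<pi> / 2\<close> makes the corresponding radius at most \<open>\<rho> q\<close>.\<close>
  obtain n :: nat where n: "real n > 1 / \<rho> q"
    using reals_Archimedean2 by blast
  have large: "1 / (c + 2 * pi * n) \<le> \<rho> q \<and> c + 2 * pi * n > 0" if "c > 0" for c
  proof -
    have "1 / \<rho> q > 0"
      using \<open>\<rho> q > 0\<close> by simp
    have "real n \<le> 2 * pi * n"
      using pi_ge_two mult_right_mono[of 1 "2 * pi" "real n"] by simp
    then have "1 / \<rho> q < c + 2 * pi * n"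
      using n that by linarith
    moreover from this have "0 < c + 2 * pi * n"
      using \<open>1 / \<rho> q > 0\<close> by linarith
    ultimately show ?thesis
      using \<open>\<rho> q > 0\<close> by (simp add: pos_divide_less_eq pos_divide_le_eq mult.commute del: distrib_left distrib_right)
  qed
  have per: "sin (c + 2 * pi * n) = sin c" for c
    using sin_2npi[of n] cos_2npi[of n] by (simp add: sin_add mult_ac)
  have "\<exists>p\<in>M. p$3 = sin (pi / 2)"
    using crest[of "pi / 2 + 2 * pi * n"] large[of "pi / 2"] per[of "pi / 2"] by auto
  then have "\<bar>1 - z\<bar> < 1"
    using flat by fastforce
  moreover have "\<exists>p\<in>M. p$3 = sin (3 * pi / 2)"
    using crest[of "3 * pi / 2 + 2 * pi * n"] large[of "3 * pi / 2"] per[of "3 * pi / 2"] by auto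
  then have "\<bar>-1 - z\<bar> < 1"
    using flat sin_3over2_pi by fastforce
  ultimately show False
    by linarith
qed

text \<open>
  Convexity of \<open>D\<close> provides connected neighbourhoods of a point, and the previous lemma applies to
  their images as soon as these are small.
\<close>

lemma openin_preimage_stem:
  fixes f :: "'b::real_normed_vector \<Rightarrow> real^3"
  assumes D: "convex D" and f: "continuous_on D f" "f ` D \<subseteq> Y"
  shows "openin (top_of_set D) (D \<inter> f -` (stem - {junction}))"
proof (subst openin_subopen, intro ballI)
  fix d assume d: "d \<in> D \<inter> f -` (stem - {junction})"
  let ?V = "- {junction} \<inter> {p. \<bar>p$3 - f d $ 3\<bar> < 1}"
  have "open ?V"
    by (intro open_Int open_Collect_less continuous_intros)
  then have "openin (top_of_set D) (D \<inter> f -` ?V)"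
    by (rule continuous_openin_preimage_gen[OF f(1)])
  moreover have "d \<in> D \<inter> f -` ?V"
    using d by auto
  ultimately obtain e where e: "e > 0" "ball d e \<inter> D \<subseteq> D \<inter> f -` ?V"
    unfolding openin_contains_ball by blast
  have "f ` (ball d e \<inter> D) \<subseteq> stem"
  proof (rule flat_connected_subset_stem)
    show "connected (f ` (ball d e \<inter> D))"
      using D f(1) by (intro connected_continuous_image convex_connected convex_Int)
        (auto intro: continuous_on_subset)
    show "f ` (ball d e \<inter> D) \<subseteq> Y - {junction}" "\<And>p. p \<in> f ` (ball d e \<inter> D) \<Longrightarrow> \<bar>p$3 - f d $ 3\<bar> < 1"
      using e(2) f(2) by auto
    have "d \<in> ball d e \<inter> D"
      using d e(1) by simp
    then show "f ` (ball d e \<inter> D) \<inter> stem \<noteq> {}"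
      using d by blast
  qed
  then show "\<exists>T. openin (top_of_set D) T \<and> d \<in> T \<and> T \<subseteq> D \<inter> f -` (stem - {junction})"
    using e d by (intro exI[of _ "ball d e \<inter> D"]) (auto simp: Int_commute openin_open_Int)
qed

text \<open>
  The parameters at which the path is on the stem form a set that is open by the previous lemma and
  closed because the stem is closed.
\<close>

lemma path_stays_in_stem:
  assumes p: "path p" "path_image p \<subseteq> Y - {junction}" and "pathstart p \<in> stem"
  shows "path_image p \<subseteq> stem"
proof -
  let ?E = "{0..1} \<inter> p -` (stem - {junction})"
  have eq: "?E = {0..1} \<inter> p -` stem"
    using p(2) by (auto simp: path_image_def)
  have cont: "continuous_on {0..1} p"
    using p(1) by (simp add: path_def)
  then have "openin (top_of_set {0..1}) ?E"
    using p(2) by (intro openin_preimage_stem) (auto simp: path_image_def)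
  moreover have "closedin (top_of_set {0..1}) ?E"
    unfolding eq using cont closed_stem by (rule continuous_closedin_preimage)
  moreover have "0 \<in> ?E"
    unfolding eq using assms(3) by (auto simp: pathstart_def)
  ultimately have "?E = {0..1}"
    by (metis connected_clopen connected_Icc empty_iff)
  then show ?thesis
    unfolding eq by (auto simp: path_image_def)
qed

end

lemma inessential_at_if_loops_in_simply_connected:
  fixes X :: "'a::real_normed_vector set"
  assumes "simply_connected E" "E \<subseteq> X" and "\<And>p. loop_at W x p \<Longrightarrow> path_image p \<subseteq> E"
  shows "inessential_at X W x"
  unfolding inessential_at_def
proof (intro allI impI)
  fix p assume p: "loop_at W x p"
  then have E: "path p" "path_image p \<subseteq> E" "pathstart p = x" "pathfinish p = x"
    using assms(3) by (auto simp: loop_at_def)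
  then have "x \<in> E"
    using pathstart_in_path_image by blast
  have "homotopic_paths E p (linepath x x)"
    using assms(1) E \<open>x \<in> E\<close> unfolding simply_connected_eq_homotopic_paths by auto
  moreover have "linepath x x = (\<lambda>_. x)"
    by (simp add: linepath_def fun_eq_iff flip: scaleR_left_distrib)
  ultimately show "homotopic_paths X p (\<lambda>_. x)"
    using assms(2) homotopic_paths_subset by metis
qed

context arc_on_sine_surface
begin

text \<open>
  On the stem the neighbourhood is everything except the junction: it contains circles around the
  axis, but no path inside it leads to them from a point of the stem.  For a point of the surface the
  set \<open>K\<close> to be removed is closed and contains the axis; what remains lies in a patch, to which the
  whole arc is attached if the point is the junction.
\<close>

lemma semilocally_simply_connected_space_Y: "semilocally_simply_connected Y"
  unfolding semilocally_simply_connected_iff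
proof
  fix x assume "x \<in> Y"
  show "\<exists>W. openin (top_of_set Y) W \<and> x \<in> W \<and> inessential_at Y W x"
  proof (cases "x \<in> stem - {junction}")
    case True
    have "inessential_at Y (Y - {junction}) x"
    proof (rule inessential_at_if_loops_in_simply_connected[OF simply_connected_stem])
      show "path_image p \<subseteq> stem" if "loop_at (Y - {junction}) x p" for p
        using that True by (intro path_stays_in_stem) (auto simp: loop_at_def)
    qed (auto simp: space_Y_eq)
    moreover have "openin (top_of_set Y) (Y - {junction})"
      by (simp add: openin_delete)
    ultimately show ?thesis
      using True \<open>x \<in> Y\<close> by blast
  next
    case False
    then have x: "x \<in> sine_surface"
      using \<open>x \<in> Y\<close> junction_in_surface by (auto simp: space_Y_eq)
    define E where "E = surface_patch x \<union> (if x = junction then path_image g else {})"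
    define K where "K = (sine_surface \<union> central_axis) \<inter>
      {p. cmod (horizontal x) / 2 \<le> cmod (horizontal p - horizontal x)} \<union>
      (if x = junction then {} else path_image g)"
    have "closed K"
      unfolding K_def using closed_arc
      by (intro closed_Un closed_Int closed_surface_axis closed_Collect_le continuous_intros) auto
    then have "openin (top_of_set Y) (Y - K)"
      by (simp add: Diff_eq closed_open openin_open_Int)
    moreover have "x \<in> Y - K"
    proof -
      have "cmod (horizontal x) > 0"
        using x by (simp add: mem_sine_surface_iff)
      moreover have "x \<notin> path_image g" if "x \<noteq> junction"
        using that False by (simp add: stem_def)
      ultimately show ?thesis
        using \<open>x \<in> Y\<close> by (simp add: K_def)
    qed
    moreover have "inessential_at Y (Y - K) x"
    proof (rule inessential_at_if_loops_in_simply_connected)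
      show "simply_connected E"
      proof (cases "x = junction")
        case True
        then show ?thesis
          using simply_connected_patch_Un_arc by (simp add: E_def)
      next
        case False
        then show ?thesis
          using AR_surface_patch(1)[OF x]
          by (simp add: E_def contractible_imp_simply_connected AR_imp_contractible)
      qed
      show "E \<subseteq> Y"
        using surface_patch_subset[OF x] by (auto simp: E_def space_Y_def)
      have "Y - K \<subseteq> E"
      proof
        fix p assume p: "p \<in> Y - K"
        show "p \<in> E"
        proof (cases "p \<in> sine_surface \<union> central_axis")
          case True
          then have near: "cmod (horizontal p - horizontal x) < cmod (horizontal x) / 2"
            using p by (simp add: K_def)
          have "p \<notin> central_axis"
            using near norm_ge_zero[of "horizontal x"] by (auto simp: mem_central_axis_iff)
          then have "p \<in> surface_patch x"
            using True near by (intro in_surface_patch) auto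
          then show ?thesis
            by (simp add: E_def)
        next
          case False
          then show ?thesis
            using p by (auto simp: space_Y_def K_def E_def split: if_splits)
        qed
      qed
      then show "path_image p \<subseteq> E" if "loop_at (Y - K) x p" for p
        using that by (auto simp: loop_at_def)
    qed
    ultimately show ?thesis
      by blast
  qed
qed

section \<open>Circles around the axis\<close>

text \<open>
  The angle as a point of the unit circle.  Constancy on the stem forces the value at the junction,
  and makes the map discontinuous along the axis.
\<close>

definition direction :: "real^3 \<Rightarrow> complex" where
  "direction p = sgn (horizontal (if p \<in> sine_surface then p else junction))"

lemma direction_stem: "p \<in> stem \<Longrightarrow> direction p = sgn (horizontal junction)"
  by (metis IntI direction_def singletonD stem_Int_surface)

lemma direction_nonzero: "direction p \<noteq> 0"
  using junction_in_surface by (auto simp: direction_def sgn_zero_iff mem_sine_surface_iff)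

lemma continuous_on_direction: "continuous_on (Y - central_axis) direction"
proof -
  let ?S = "(Y - central_axis) \<inter> (sine_surface \<union> central_axis)" and ?T = "(Y - central_axis) \<inter> path_image g"
  have eq: "Y - central_axis = ?S \<union> ?T"
    by (auto simp: space_Y_def)
  have "continuous_on (?S \<union> ?T) direction"
  proof (rule continuous_on_Un_local)
    show "closedin (top_of_set (?S \<union> ?T)) ?S" "closedin (top_of_set (?S \<union> ?T)) ?T"
      unfolding eq[symmetric] by (intro closedin_closed_Int closed_surface_axis closed_arc)+
    have "continuous_on ?S (\<lambda>p. sgn (horizontal p))"
      by (intro continuous_intros) (auto simp: mem_sine_surface_iff)
    then show "continuous_on ?S direction"
      by (rule continuous_on_eq) (auto simp: direction_def)
    show "continuous_on ?T direction"
      by (rule continuous_on_eq[of _ "\<lambda>_. sgn (horizontal junction)"]) (auto simp: direction_stem stem_def)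
  qed
  then show ?thesis
    unfolding eq[symmetric] .
qed

text \<open>
  Near a parameter that is mapped to the axis, the composition is constant, because \<open>f\<close> stays on the
  stem there; elsewhere the direction itself is continuous.
\<close>

lemma continuous_on_direction_compose:
  fixes f :: "'b::real_normed_vector \<Rightarrow> real^3"
  assumes D: "convex D" and f: "continuous_on D f" "f ` D \<subseteq> Y"
  shows "continuous_on D (direction \<circ> f)"
proof -
  let ?S = "D \<inter> f -` (- central_axis)" and ?T = "D \<inter> f -` (stem - {junction})"
  have "central_axis \<subseteq> stem - {junction}"
    using surface_axis_disjoint junction_in_surface by (auto simp: stem_def)
  then have eq: "D = ?S \<union> ?T"
    by blast
  have "continuous_on (?S \<union> ?T) (direction \<circ> f)"
  proof (rule continuous_on_Un_local_open)
    show "openin (top_of_set (?S \<union> ?T)) ?S"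
      unfolding eq[symmetric] using f(1) closed_central_axis
      by (simp add: continuous_openin_preimage_gen open_Compl)
    show "openin (top_of_set (?S \<union> ?T)) ?T"
      unfolding eq[symmetric] using assms by (rule openin_preimage_stem)
    show "continuous_on ?S (direction \<circ> f)"
      using f by (intro continuous_on_compose continuous_on_subset[OF continuous_on_direction])
        (auto intro: continuous_on_subset)
    show "continuous_on ?T (direction \<circ> f)"
      by (rule continuous_on_eq[of _ "\<lambda>_. sgn (horizontal junction)"]) (auto simp: direction_stem)
  qed
  then show ?thesis
    unfolding eq[symmetric] .
qed

definition parallel_circle :: "real \<Rightarrow> real \<Rightarrow> real^3" where
  "parallel_circle r t = sine_graph (of_real r * exp (2 * of_real pi * \<i> * of_real t))"

text \<open>
  A null-homotopy in \<open>Y\<close>, followed by the direction, would contract the standard parametrisation of the unit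
  circle in the punctured plane, against its winding number.
\<close>

lemma parallel_circle_essential:
  assumes "0 < r" "r \<le> 1"
  shows "\<not> homotopic_paths Y (parallel_circle r) (\<lambda>_. y)"
proof
  assume "homotopic_paths Y (parallel_circle r) (\<lambda>_. y)"
  then obtain h :: "real \<times> real \<Rightarrow> real^3" where h: "continuous_on ({0..1} \<times> {0..1}) h" "h \<in> {0..1} \<times> {0..1} \<rightarrow> Y"
    "\<forall>x\<in>{0..1}. h (0, x) = parallel_circle r x" "\<forall>x\<in>{0..1}. h (1, x) = y"
    "\<forall>t\<in>{0..1}. h (t, 0) = parallel_circle r 0 \<and> h (t, 1) = parallel_circle r 1"
    unfolding homotopic_paths by (auto simp: pathstart_def pathfinish_def)
  have circle: "direction (parallel_circle r t) = circlepath 0 1 t" for t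
  proof -
    define w where "w = of_real r * exp (2 * of_real pi * \<i> * of_real t)"
    have "cmod w = r"
      using assms by (simp add: w_def norm_mult)
    then have "sine_graph w \<in> sine_surface"
      using assms by (auto simp: sine_surface_eq_image)
    then show ?thesis
      using assms \<open>cmod w = r\<close>
      by (simp add: direction_def parallel_circle_def circlepath sgn_eq flip: w_def) (simp add: w_def)
  qed
  have "continuous_on ({0..1} \<times> {0..1}) (direction \<circ> h)"
    using h by (intro continuous_on_direction_compose convex_Times) auto
  then have "homotopic_paths (- {0}) (circlepath 0 1) (\<lambda>_. direction y)"
    unfolding homotopic_paths using h(3-) direction_nonzero
    by (intro exI[of _ "direction \<circ> h"]) (auto simp: circle pathstart_def pathfinish_def)
  then have "winding_number (circlepath 0 1) 0 = winding_number (\<lambda>_. direction y) 0"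
    by (rule winding_number_homotopic_paths)
  moreover have "(\<lambda>_. direction y) = linepath (direction y) (direction y)"
    by (simp add: linepath_def fun_eq_iff flip: scaleR_left_distrib)
  then have "winding_number (\<lambda>_. direction y) 0 = 0"
    using direction_nonzero by (metis winding_number_trivial)
  ultimately show False
    by (simp add: winding_number_circlepath_centre)
qed

text \<open>
  The circles of radius \<open>1 / (n \<pi>)\<close> lie at height \<open>0\<close> and shrink to the origin.
\<close>

lemma not_unbased_semilocally_simply_connected_space_Y:
  "\<not> unbased_semilocally_simply_connected Y"
proof
  assume "unbased_semilocally_simply_connected Y"
  moreover have "0 \<in> Y"
    by (auto simp: space_Y_def mem_central_axis_iff horizontal_def complex_eq_iff)
  ultimately obtain W where W: "openin (top_of_set Y) W" "0 \<in> W" and iness: "\<And>y. inessential_at Y W y"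
    unfolding unbased_semilocally_simply_connected_iff by blast
  then obtain e where e: "e > 0" "ball 0 e \<inter> Y \<subseteq> W"
    unfolding openin_contains_ball by blast
  \<comment> \<open>The factor \<open>2\<close> leaves room for bounding the norm of a point by the sum of its coordinates.\<close>
  obtain n :: nat where n: "real n > max 1 (2 / e)"
    using reals_Archimedean2 by blast
  define N where "N = pi * real n"
  have "real n \<le> N"
    unfolding N_def using pi_ge_two mult_right_mono[of 1 pi "real n"] by simp
  then have N: "1 < N" "2 / e < N"
    using n by auto
  define r where "r = 1 / N"
  have r: "0 < r" "r \<le> 1" "2 * r < e"
    using N e(1) by (auto simp: r_def field_simps)
  have node: "sin (1 / r) = 0"
    by (simp add: r_def N_def mult.commute)
  let ?c = "parallel_circle r"
  have c: "\<exists>w. cmod w = r \<and> ?c t = sine_graph w" for t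
    using r(1) by (intro exI[of _ "of_real r * exp (2 * of_real pi * \<i> * of_real t)"])
      (simp add: parallel_circle_def norm_mult)
  have "path ?c"
    unfolding path_def parallel_circle_def using r(1)
    by (intro continuous_on_compose2[OF continuous_on_sine_graph[of "- {0}"]] continuous_intros) auto
  moreover have "path_image ?c \<subseteq> W"
  proof -
    have "?c t \<in> ball 0 e \<inter> Y" for t
    proof -
      obtain w where w: "cmod w = r" "?c t = sine_graph w"
        using c by blast
      have "norm (sine_graph w) \<le> \<bar>Re w\<bar> + \<bar>Im w\<bar>"
        using norm_le_l1_cart[of "sine_graph w"] w(1) node by (simp add: sine_graph_def sum_3)
      also have "\<dots> \<le> 2 * r"
        using abs_Re_le_cmod[of w] abs_Im_le_cmod[of w] w(1) by linarith
      finally have "?c t \<in> ball 0 e"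
        using w(2) r(3) by simp
      moreover have "?c t \<in> sine_surface"
        using w r by (auto simp: sine_surface_eq_image)
      ultimately show ?thesis
        by (simp add: space_Y_def)
    qed
    then show ?thesis
      using e(2) by (auto simp: path_image_def)
  qed
  moreover have "?c 1 = ?c 0"
    by (simp add: parallel_circle_def exp_two_pi_i exp_two_pi_i' mult.commute)
  ultimately have "loop_at W (?c 0) ?c"
    by (simp add: loop_at_def pathstart_def pathfinish_def)
  from inessential_atD[OF iness this] show False
    using parallel_circle_essential r by blast
qed

lemma not_locally_path_connected_space_Y: "\<not> locally path_connected Y"
  using based_imp_unbased_semilocally_simply_connected semilocally_simply_connected_space_Y
    not_unbased_semilocally_simply_connected_space_Y by blast

end

section \<open>Coverings, Spanier groups and the example\<close>

theorem theorem2p8: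
  shows
   "(\<forall>(X::'a::topological_space set) x0. path_connected X \<and> x0 \<in> X \<longrightarrow>
        (unbased_semilocally_simply_connected X \<longleftrightarrow>
         (\<exists>\<U>. open_covering X \<U> \<and>
            unbased_spanier_group X \<U> x0 = {\<one>\<^bsub>fundamental_group X x0\<^esub>}))) \<and>
    (\<forall>(X::'a set) x0. path_connected X \<and> x0 \<in> X \<longrightarrow>
        (semilocally_simply_connected X \<longleftrightarrow>
         (\<exists>\<V>. pointed_open_covering X \<V> \<and>
            based_spanier_group X \<V> x0 = {\<one>\<^bsub>fundamental_group X x0\<^esub>}))) \<and>
    (\<forall>(X::'a set). path_connected X \<longrightarrow>
        (unbased_semilocally_simply_connected X \<longrightarrow> semilocally_simply_connected X) \<and>
        (\<forall>x0\<in>X.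
          (\<exists>\<U>. open_covering X \<U> \<and>
             unbased_spanier_group X \<U> x0 = {\<one>\<^bsub>fundamental_group X x0\<^esub>}) \<longrightarrow>
          (\<exists>\<V>. pointed_open_covering X \<V> \<and>
             based_spanier_group X \<V> x0 = {\<one>\<^bsub>fundamental_group X x0\<^esub>}))) \<and>
    (\<forall>(X::'a set). path_connected X \<and> locally path_connected X \<longrightarrow>
        (semilocally_simply_connected X \<longrightarrow> unbased_semilocally_simply_connected X) \<and>
        (\<forall>x0\<in>X.
          (\<exists>\<V>. pointed_open_covering X \<V> \<and>
             based_spanier_group X \<V> x0 = {\<one>\<^bsub>fundamental_group X x0\<^esub>}) \<longrightarrow>
          (\<exists>\<U>. open_covering X \<U> \<and>
             unbased_spanier_group X \<U> x0 = {\<one>\<^bsub>fundamental_group X x0\<^esub>}))) \<and>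
    (\<exists>g. connecting_arc g) \<and>
    (\<forall>g. connecting_arc g \<longrightarrow>
        path_connected (space_Y g) \<and> \<not> locally path_connected (space_Y g) \<and>
        semilocally_simply_connected (space_Y g) \<and>
        \<not> unbased_semilocally_simply_connected (space_Y g) \<and>
        (\<forall>x0\<in>space_Y g.
          (\<exists>\<V>. pointed_open_covering (space_Y g) \<V> \<and>
             based_spanier_group (space_Y g) \<V> x0 = {\<one>\<^bsub>fundamental_group (space_Y g) x0\<^esub>}) \<and>
          \<not> (\<exists>\<U>. open_covering (space_Y g) \<U> \<and>
             unbased_spanier_group (space_Y g) \<U> x0 = {\<one>\<^bsub>fundamental_group (space_Y g) x0\<^esub>})))"
proof -
  let ?U = "\<lambda>(X::'a set) x0. \<exists>\<U>. open_covering X \<U> \<and>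
    unbased_spanier_group X \<U> x0 = {\<one>\<^bsub>fundamental_group X x0\<^esub>}"
  let ?V = "\<lambda>(X::'a set) x0. \<exists>\<V>. pointed_open_covering X \<V> \<and>
    based_spanier_group X \<V> x0 = {\<one>\<^bsub>fundamental_group X x0\<^esub>}"
  have unbased: "unbased_semilocally_simply_connected X \<longleftrightarrow> ?U X x0"
    and based: "semilocally_simply_connected X \<longleftrightarrow> ?V X x0"
    if "path_connected X" "x0 \<in> X" for X :: "'a set" and x0
    using unbased_semilocally_simply_connected_iff_spanier[OF that]
      semilocally_simply_connected_iff_spanier[OF that] .
  show ?thesis
  proof (intro conjI)
    show "\<forall>(X::'a set) x0. path_connected X \<and> x0 \<in> X \<longrightarrow>
        (unbased_semilocally_simply_connected X \<longleftrightarrow> ?U X x0)"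
      using unbased by simp
    show "\<forall>(X::'a set) x0. path_connected X \<and> x0 \<in> X \<longrightarrow>
        (semilocally_simply_connected X \<longleftrightarrow> ?V X x0)"
      using based by simp
    show "\<forall>(X::'a set). path_connected X \<longrightarrow>
        (unbased_semilocally_simply_connected X \<longrightarrow> semilocally_simply_connected X) \<and>
        (\<forall>x0\<in>X. ?U X x0 \<longrightarrow> ?V X x0)"
      using unbased_imp_based_semilocally_simply_connected by (auto simp flip: unbased based)
    show "\<forall>(X::'a set). path_connected X \<and> locally path_connected X \<longrightarrow>
        (semilocally_simply_connected X \<longrightarrow> unbased_semilocally_simply_connected X) \<and>
        (\<forall>x0\<in>X. ?V X x0 \<longrightarrow> ?U X x0)"
      using based_imp_unbased_semilocally_simply_connected by (auto simp flip: unbased based)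
    show "\<exists>g. connecting_arc g"
      by (rule connecting_arc_exists)
    show "\<forall>g. connecting_arc g \<longrightarrow>
        path_connected (space_Y g) \<and> \<not> locally path_connected (space_Y g) \<and>
        semilocally_simply_connected (space_Y g) \<and>
        \<not> unbased_semilocally_simply_connected (space_Y g) \<and>
        (\<forall>x0\<in>space_Y g.
          (\<exists>\<V>. pointed_open_covering (space_Y g) \<V> \<and>
             based_spanier_group (space_Y g) \<V> x0 = {\<one>\<^bsub>fundamental_group (space_Y g) x0\<^esub>}) \<and>
          \<not> (\<exists>\<U>. open_covering (space_Y g) \<U> \<and>
             unbased_spanier_group (space_Y g) \<U> x0 = {\<one>\<^bsub>fundamental_group (space_Y g) x0\<^esub>}))"
    proof (intro allI impI)
      fix g assume "connecting_arc g"
      then interpret arc_on_sine_surface g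
        by unfold_locales
      note Y = path_connected_space_Y semilocally_simply_connected_space_Y
        not_unbased_semilocally_simply_connected_space_Y
      show "path_connected Y \<and> \<not> locally path_connected Y \<and> semilocally_simply_connected Y \<and>
          \<not> unbased_semilocally_simply_connected Y \<and>
          (\<forall>x0\<in>Y. (\<exists>\<V>. pointed_open_covering Y \<V> \<and>
               based_spanier_group Y \<V> x0 = {\<one>\<^bsub>fundamental_group Y x0\<^esub>}) \<and>
            \<not> (\<exists>\<U>. open_covering Y \<U> \<and>
               unbased_spanier_group Y \<U> x0 = {\<one>\<^bsub>fundamental_group Y x0\<^esub>}))"
        using Y not_locally_path_connected_space_Y
        by (simp flip: unbased_semilocally_simply_connected_iff_spanier
            semilocally_simply_connected_iff_spanier)
    qed
  qed
qed

end
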